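(* Let $x=(x^1,x^2,x^3,x^4)\in M(2,\mathbb{C})^4$ be a point of $X^\circ$, i.e. $x$ satisfies the conditions: (g1) every $H_p$ is irreducible, i.e. $D(pp)\neq0$; (g2) $H_p$ and $H_q$ have two different intersection points, i.e. $D(pq)^2-D(pp)D(qq)\ne0$, for any $p\neq q$; (g3) $H_p\cap H_q\cap H_r=\emptyset$, i.e. $D(pqr)\neq0$, for any $p,q,r$ with $(p-q)(q-r)(r-p)\ne0$. Then any local solution around the point $x\in X^\circ$ of the system of differential equations $E_1+E_2$ is locally holomorphic.
   Context: Indices $p,q,r$ run over $\{1,2,3,4\}$. Write $x^p=\begin{pmatrix} x^p_{11} & x^p_{12} \\ x^p_{21} & x^p_{22} \end{pmatrix}$. In $\mathbb{P}^1\times\mathbb{P}^1$ with homogeneous coordinates $[\xi_1,\xi_2],[\eta_1,\eta_2]$, $H_p$ is the curve $x^p_{11}\xi_1\eta_1+x^p_{12}\xi_1\eta_2+x^p_{21}\xi_2\eta_1+x^p_{22}\xi_2\eta_2=0$. $X^\circ\subset M(2,\mathbb{C})^4$ is the set of points satisfying (g1)–(g3). $D(pq)=x^p_{11}x^q_{22}+x^p_{22}x^q_{11}-x^p_{12}x^q_{21}-x^p_{21}x^q_{12}$. Let $M_{pqr}$ be the $3\times4$ matrix with rows $(x^a_{11},x^a_{12},x^a_{21},x^a_{22})$ for $a=p,q,r$, and $(ijk)$ its $3\times3$ minor on columns $i,j,k$; $D(pqr)=(234)(123)-(134)(124)$. The system $E_1+E_2$ for an unknown function $u(x)$ of the 16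 variables $x^p_{jk}$ is the following. $E_1$: $$\sum_{1\le j,k\le2}x^p_{jk}\frac{\partial u}{\partial x^p_{jk}}=-\tfrac12u\ (p=1,\dots,4),\quad \sum_{p=1}^4\sum_{j=1}^2x^p_{\ell j}\frac{\partial u}{\partial x^p_{mj}}=-\delta_{\ell m}u,\quad \sum_{p=1}^4\sum_{j=1}^2x^p_{j\ell}\frac{\partial u}{\partial x^p_{jm}}=-\delta_{\ell m}u\quad(\ell,m\in\{1,2\}).$$ $E_2$: $$\frac{\partial^2u}{\partial x^q_{ij}\partial x^p_{k\ell}}=\frac{\partial^2u}{\partial x^q_{k\ell}\partial x^p_{ij}}\ (i,j,k,\ell\in\{1,2\}),\qquad \frac{\partial^2u}{\partial x^q_{11}\partial x^p_{22}}=\frac{\partial^2u}{\partial x^q_{21}\partial x^p_{12}}\quad(p,q\in\{1,2,3,4\}).$$ *)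

theory Defs
  imports "HOL-Analysis.Analysis"
begin

text \<open>
  A point x of M(2,C)^4 has entries \<open>x $ p $ j $ k\<close>. In the index types 2, 3 and 4 the numeral
  equal to the cardinality denotes the same element as 0, so quantifying over the type is
  quantifying over 1, ..., n.
\<close>

type_synonym pt = "complex ^ 2 ^ 2 ^ 4"

definition D2 :: "pt \<Rightarrow> 4 \<Rightarrow> 4 \<Rightarrow> complex" where
  "D2 x p q = x$p$1$1 * x$q$2$2 + x$p$2$2 * x$q$1$1 - x$p$1$2 * x$q$2$1 - x$p$2$1 * x$q$1$2"

definition coeff_row :: "pt \<Rightarrow> 4 \<Rightarrow> complex ^ 4" where
  "coeff_row x p = vector [x$p$1$1, x$p$1$2, x$p$2$1, x$p$2$2]"

definition coeff_mat :: "pt \<Rightarrow> 4 \<Rightarrow> 4 \<Rightarrow> 4 \<Rightarrow> complex ^ 4 ^ 3" where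
  "coeff_mat x p q r = vector [coeff_row x p, coeff_row x q, coeff_row x r]"

definition minor3 :: "complex ^ 4 ^ 3 \<Rightarrow> 4 \<Rightarrow> 4 \<Rightarrow> 4 \<Rightarrow> complex" where
  "minor3 M i j k = det (vector [column i M, column j M, column k M] :: complex ^ 3 ^ 3)"
  \<comment> \<open>The selected columns are placed as rows; the determinant is invariant under transposition.\<close>

definition D3 :: "pt \<Rightarrow> 4 \<Rightarrow> 4 \<Rightarrow> 4 \<Rightarrow> complex" where
  "D3 x p q r = (let M = coeff_mat x p q r in
     minor3 M 2 3 4 * minor3 M 1 2 3 - minor3 M 1 3 4 * minor3 M 1 2 4)"

definition X_circ :: "pt set" where
  "X_circ = {x.
     (\<forall>p. D2 x p p \<noteq> 0) \<and>
     (\<forall>p q. p \<noteq> q \<longrightarrow> (D2 x p q)\<^sup>2 - D2 x p p * D2 x q q \<noteq> 0) \<and>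
     (\<forall>p q r. p \<noteq> q \<and> q \<noteq> r \<and> r \<noteq> p \<longrightarrow> D3 x p q r \<noteq> 0)}"

definition shift :: "4 \<Rightarrow> 2 \<Rightarrow> 2 \<Rightarrow> pt \<Rightarrow> complex \<Rightarrow> pt" where
  "shift p j k z t = (\<chi> q i l. if q = p \<and> i = j \<and> l = k then z$q$i$l + t else z$q$i$l)"

text \<open>
  Partial derivatives are one-variable complex derivatives along a coordinate line. They are
  meaningful only where they exist, which \<open>partially_differentiable\<close> expresses.
\<close>

definition partially_differentiable :: "4 \<Rightarrow> 2 \<Rightarrow> 2 \<Rightarrow> (pt \<Rightarrow> complex) \<Rightarrow> pt \<Rightarrow> bool" where
  "partially_differentiable p j k u z \<longleftrightarrow> (\<lambda>t. u (shift p j k z t)) field_differentiable (at 0)"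

definition pd :: "4 \<Rightarrow> 2 \<Rightarrow> 2 \<Rightarrow> (pt \<Rightarrow> complex) \<Rightarrow> pt \<Rightarrow> complex" where
  "pd p j k u z = deriv (\<lambda>t. u (shift p j k z t)) 0"

definition E1 :: "(pt \<Rightarrow> complex) \<Rightarrow> pt \<Rightarrow> bool" where
  "E1 u z \<longleftrightarrow>
     (\<forall>p. (\<Sum>j\<in>UNIV. \<Sum>k\<in>UNIV. z$p$j$k * pd p j k u z) = - (1/2) * u z) \<and>
     (\<forall>l m. (\<Sum>p\<in>UNIV. \<Sum>j\<in>UNIV. z$p$l$j * pd p m j u z) = - (if l = m then 1 else 0) * u z) \<and>
     (\<forall>l m. (\<Sum>p\<in>UNIV. \<Sum>j\<in>UNIV. z$p$j$l * pd p j m u z) = - (if l = m then 1 else 0) * u z)"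

definition E2 :: "(pt \<Rightarrow> complex) \<Rightarrow> pt \<Rightarrow> bool" where
  "E2 u z \<longleftrightarrow>
     (\<forall>p q i j k l. pd q i j (pd p k l u) z = pd q k l (pd p i j u) z) \<and>
     (\<forall>p q. pd q 1 1 (pd p 2 2 u) z = pd q 2 1 (pd p 1 2 u) z)"

text \<open>
  A solution is not assumed to be holomorphic in several variables: it is continuous, and the
  complex partial derivatives that occur in the system exist and satisfy it. The set V is meant to be open.
  It need not contain the point around which one works, so that branches of multivalued solutions,
  living on slit neighbourhoods or sectors near that point, are also covered.
\<close>

definition solution_on :: "pt set \<Rightarrow> (pt \<Rightarrow> complex) \<Rightarrow> bool" where
  "solution_on V u \<longleftrightarrow> continuous_on V u \<and>
     (\<forall>z\<in>V. (\<forall>p j k. partially_differentiable p j k u z) \<and>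
            (\<forall>p q i j k l. partially_differentiable q i j (pd p k l u) z) \<and>
            E1 u z \<and> E2 u z)"

text \<open>Holomorphy on an open set is Frechet differentiability with complex linear derivative.\<close>

definition holomorphic_pt_on :: "pt set \<Rightarrow> (pt \<Rightarrow> complex) \<Rightarrow> bool" where
  "holomorphic_pt_on S u \<longleftrightarrow> (\<forall>z\<in>S. \<exists>c :: pt.
     (u has_derivative (\<lambda>h. \<Sum>p\<in>UNIV. \<Sum>j\<in>UNIV. \<Sum>k\<in>UNIV. c$p$j$k * h$p$j$k)) (at z))"

end

(*
  The principal symbols of E1 and E2 have no common zero over a point of X_circ besides 0: the
  symbols of E2 cut out the Segre cone of the covectors a_p s_i t_j, the symbols of E1 make (s,t) a
  point of H_p whenever a_p is nonzero and make the tangents there cancel, and (g1)-(g3) exclude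
  one, two or three nonzero a_p. In dual form, already a symmetric tensor of degree 3 killed by
  the symbols is 0. Hence near such a point all third derivatives of a solution are linear
  combinations, with holomorphic coefficients, of its second derivatives, so that the second
  derivatives satisfy a Pfaffian system on a fixed ball B. Starting from any point of V, this
  system is solved on B by Picard iteration along segments, and u itself is recovered from its
  second derivatives by homogeneity.
*)
theory Submission
  imports Defs "HOL-Complex_Analysis.Conformal_Mappings"
begin

section \<open>Separately holomorphic functions\<close>

text \<open>The dual form of the symbol condition is the kernel condition of a linear system at
  \<open>x\<close>: since only the zero tensor of degree 3 satisfies all relations, they determine
  the third derivatives, and one nonvanishing determinant carries this to a neighbourhood. A
  statement about common zeros alone would leave the degree open. A solution is given only as a
  continuous function with complex partial derivatives, so the right to differentiate the equations
  twice and to interchange derivatives has to be earned, by uniform limits of difference quotients.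
  Integrability of the Pfaffian system away from V is not at hand. Iteration along segments makes
  sense all the same, as a contraction on the whole ball; the second derivatives of \<open>u\<close>
  are a fixed point near the starting point, so the limit agrees with them there, and the identity
  theorem carries this to V. As the system is linear, the radius depends only on bounds for its
  coefficients, hence neither on V nor on \<open>u\<close>.\<close>

lemma norm_vector_scalar_mult: "norm (c *s z) = norm c * norm z"
  for z :: "complex ^ 'n"
  by (simp add: norm_vec_def norm_mult L2_set_right_distrib)

lemma norm_axis_one [simp]: "norm (t *s axis i 1 :: complex ^ 'n) = norm t"
  by (simp add: norm_vector_scalar_mult norm_axis_1)

lemma tendsto_vector_scalar_mult [tendsto_intros]:
  fixes f :: "_ \<Rightarrow> complex" and g :: "_ \<Rightarrow> complex ^ 'n"
  shows "(f \<longlongrightarrow> a) F \<Longrightarrow> (g \<longlongrightarrow> b) F \<Longrightarrow> ((\<lambda>x. f x *s g x) \<longlongrightarrow> a *s b) F"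
  unfolding vector_scalar_mult_def by (intro tendsto_intros)

lemma continuous_on_vector_scalar_mult [continuous_intros]:
  fixes f :: "_ \<Rightarrow> complex" and g :: "_ \<Rightarrow> complex ^ 'n"
  shows "continuous_on S f \<Longrightarrow> continuous_on S g \<Longrightarrow> continuous_on S (\<lambda>x. f x *s g x)"
  unfolding continuous_on_def by (blast intro: tendsto_vector_scalar_mult)

section \<open>Partial derivatives along coordinate lines\<close>

definition cpd :: "'n \<Rightarrow> (complex ^ 'n \<Rightarrow> complex) \<Rightarrow> complex ^ 'n \<Rightarrow> complex" where
  "cpd i f z = deriv (\<lambda>t. f (z + t *s axis i 1)) 0"

text \<open>Continuity is part of the notion, as in Osgood's lemma: it makes \<open>f\<close>
  bounded on compact sets, which is where Cauchy's estimates start.\<close>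

definition sep_hol :: "(complex ^ 'n) set \<Rightarrow> (complex ^ 'n \<Rightarrow> complex) \<Rightarrow> bool" where
  "sep_hol S f \<longleftrightarrow> continuous_on S f \<and>
     (\<forall>z\<in>S. \<forall>i. (\<lambda>t. f (z + t *s axis i 1)) field_differentiable (at 0))"

lemma sep_hol_DERIV:
  assumes "sep_hol S f" "z + t *s axis i 1 \<in> S"
  shows "((\<lambda>t. f (z + t *s axis i 1)) has_field_derivative cpd i f (z + t *s axis i 1)) (at t)"
proof -
  have "(\<lambda>s. f (z + t *s axis i 1 + s *s axis i 1)) field_differentiable (at 0)"
    using assms unfolding sep_hol_def by blast
  hence "((\<lambda>s. f (z + t *s axis i 1 + s *s axis i 1)) has_field_derivative
      cpd i f (z + t *s axis i 1)) (at 0)"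
    unfolding cpd_def by (simp add: DERIV_deriv_iff_field_differentiable)
  hence "((\<lambda>s. f (z + (s + t) *s axis i 1)) has_field_derivative
      cpd i f (z + t *s axis i 1)) (at 0)"
    by (simp add: add_ac vec.scale_left_distrib)
  thus ?thesis
    using DERIV_shift[of "\<lambda>t. f (z + t *s axis i 1)" _ 0 t] by simp
qed

lemma sep_hol_DERIV0:
  assumes "sep_hol S f" "z \<in> S"
  shows "((\<lambda>t. f (z + t *s axis i 1)) has_field_derivative cpd i f z) (at 0)"
  using sep_hol_DERIV[OF assms(1), of z 0 i] assms(2) by simp

lemma sep_holI:
  assumes "continuous_on S f"
    and "\<And>z i. z \<in> S \<Longrightarrow> ((\<lambda>t. f (z + t *s axis i 1)) has_field_derivative d i z) (at 0)"
  shows "sep_hol S f" "z \<in> S \<Longrightarrow> cpd i f z = d i z"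
  using assms by (auto simp: sep_hol_def field_differentiable_def cpd_def DERIV_imp_deriv)

lemma sep_hol_continuous_on: "sep_hol S f \<Longrightarrow> continuous_on S f"
  by (simp add: sep_hol_def)

lemma sep_hol_subset: "sep_hol S f \<Longrightarrow> T \<subseteq> S \<Longrightarrow> sep_hol T f"
  by (auto simp: sep_hol_def intro: continuous_on_subset)

lemma sep_hol_local:
  assumes "\<And>z. z \<in> S \<Longrightarrow> \<exists>U. open U \<and> z \<in> U \<and> sep_hol U f"
  shows "sep_hol S f"
  unfolding sep_hol_def
proof (intro conjI ballI allI)
  show "continuous_on S f"
  proof (rule continuous_at_imp_continuous_on, rule ballI)
    fix z assume "z \<in> S"
    then obtain U where "open U" "z \<in> U" "continuous_on U f"
      using assms unfolding sep_hol_def by metis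
    thus "isCont f z" using continuous_on_eq_continuous_at by blast
  qed
qed (use assms in \<open>auto simp: sep_hol_def\<close>)

lemma slice_open:
  fixes z :: "complex ^ 'n"
  assumes "open S"
  shows "open {t. z + t *s axis i 1 \<in> S}"
proof -
  have "continuous_on UNIV (\<lambda>t. z + t *s axis i 1)" by (intro continuous_intros)
  from open_vimage[OF assms this] show ?thesis by (simp add: vimage_def)
qed

lemma slice_eventually:
  fixes z :: "complex ^ 'n"
  assumes "open S" "z \<in> S"
  shows "\<forall>\<^sub>F t in nhds 0. z + t *s axis i 1 \<in> S"
  using eventually_nhds_in_open[OF slice_open[OF assms(1), of z i], of 0] assms(2) by simp

lemma sep_hol_cong:
  assumes "sep_hol S f" "open S" "\<And>z. z \<in> S \<Longrightarrow> f z = g z"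
  shows "sep_hol S g" "z \<in> S \<Longrightarrow> cpd i g z = cpd i f z"
proof -
  have "((\<lambda>t. g (z + t *s axis i 1)) has_field_derivative cpd i f z) (at 0)" if "z \<in> S" for z i
  proof (subst DERIV_cong_ev[OF refl _ refl])
    show "\<forall>\<^sub>F t in nhds 0. g (z + t *s axis i 1) = f (z + t *s axis i 1)"
      using slice_eventually[OF assms(2) that, of i] by eventually_elim (simp add: assms(3))
    show "((\<lambda>t. f (z + t *s axis i 1)) has_field_derivative cpd i f z) (at 0)"
      by (rule sep_hol_DERIV0[OF assms(1) that])
  qed
  moreover have "continuous_on S g"
    using assms by (simp add: sep_hol_def cong: continuous_on_cong)
  ultimately show "sep_hol S g" "z \<in> S \<Longrightarrow> cpd i g z = cpd i f z"
    using sep_holI[of S g "\<lambda>i. cpd i f"] by blast+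
qed

lemma sep_hol_const: "sep_hol S (\<lambda>_. c)"
  and cpd_const: "cpd i (\<lambda>_. c) z = 0"
  by (simp_all add: sep_hol_def cpd_def)

lemma sep_hol_coord: "sep_hol S (\<lambda>z. z $ k)"
  and cpd_coord: "cpd i (\<lambda>z. z $ k) z = (if i = k then 1 else 0)"
proof -
  have "((\<lambda>t. (z + t *s axis i 1) $ k) has_field_derivative (if i = k then 1 else 0)) (at 0)"
    for z and i :: 'a
    by (auto simp: axis_def intro!: derivative_eq_intros)
  note d = this
  have c: "continuous_on S (\<lambda>z :: complex ^ 'a. z $ k)" for S by (intro continuous_intros)
  show "sep_hol S (\<lambda>z. z $ k)" by (rule sep_holI(1)[OF c d])
  show "cpd i (\<lambda>z. z $ k) z = (if i = k then 1 else 0)"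
    by (rule sep_holI(2)[OF c d UNIV_I])
qed

lemma
  assumes f: "sep_hol S f" and g: "sep_hol S g"
  shows sep_hol_add: "sep_hol S (\<lambda>z. f z + g z)"
    and cpd_add: "z \<in> S \<Longrightarrow> cpd i (\<lambda>z. f z + g z) z = cpd i f z + cpd i g z"
    and sep_hol_diff: "sep_hol S (\<lambda>z. f z - g z)"
    and cpd_diff: "z \<in> S \<Longrightarrow> cpd i (\<lambda>z. f z - g z) z = cpd i f z - cpd i g z"
    and sep_hol_mult: "sep_hol S (\<lambda>z. f z * g z)"
    and cpd_mult: "z \<in> S \<Longrightarrow> cpd i (\<lambda>z. f z * g z) z = cpd i f z * g z + f z * cpd i g z"
proof -
  note cfg = sep_hol_continuous_on[OF f] sep_hol_continuous_on[OF g]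
  note c = continuous_on_add[OF cfg] continuous_on_diff[OF cfg] continuous_on_mult[OF cfg]
  note d = sep_hol_DERIV0[OF f] sep_hol_DERIV0[OF g]
  have 1: "((\<lambda>t. f (z + t *s axis i 1) + g (z + t *s axis i 1)) has_field_derivative
      cpd i f z + cpd i g z) (at 0)" if "z \<in> S" for z i
    using that by (auto intro!: derivative_eq_intros d)
  have 2: "((\<lambda>t. f (z + t *s axis i 1) - g (z + t *s axis i 1)) has_field_derivative
      cpd i f z - cpd i g z) (at 0)" if "z \<in> S" for z i
    using that by (auto intro!: derivative_eq_intros d)
  have 3: "((\<lambda>t. f (z + t *s axis i 1) * g (z + t *s axis i 1)) has_field_derivative
      cpd i f z * g z + f z * cpd i g z) (at 0)" if "z \<in> S" for z i
    using that by (auto intro!: derivative_eq_intros d)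
  show "sep_hol S (\<lambda>z. f z + g z)"
    "z \<in> S \<Longrightarrow> cpd i (\<lambda>z. f z + g z) z = cpd i f z + cpd i g z"
    using sep_holI[OF c(1) 1] by blast+
  show "sep_hol S (\<lambda>z. f z - g z)"
    "z \<in> S \<Longrightarrow> cpd i (\<lambda>z. f z - g z) z = cpd i f z - cpd i g z"
    using sep_holI[OF c(2) 2] by blast+
  show "sep_hol S (\<lambda>z. f z * g z)"
    "z \<in> S \<Longrightarrow> cpd i (\<lambda>z. f z * g z) z = cpd i f z * g z + f z * cpd i g z"
    using sep_holI[OF c(3) 3] by blast+
qed

lemma sep_hol_divide:
  assumes f: "sep_hol S f" and g: "sep_hol S g" and nz: "\<And>z. z \<in> S \<Longrightarrow> g z \<noteq> 0"
  shows "sep_hol S (\<lambda>z. f z / g z)"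
  using assms unfolding sep_hol_def
  by (auto intro!: continuous_intros field_differentiable_divide)

lemma
  assumes "\<And>a. a \<in> A \<Longrightarrow> sep_hol S (f a)"
  shows sep_hol_sum: "sep_hol S (\<lambda>z. \<Sum>a\<in>A. f a z)"
    and cpd_sum: "z \<in> S \<Longrightarrow> cpd i (\<lambda>z. \<Sum>a\<in>A. f a z) z = (\<Sum>a\<in>A. cpd i (f a) z)"
proof -
  have "((\<lambda>t. \<Sum>a\<in>A. f a (z + t *s axis i 1)) has_field_derivative (\<Sum>a\<in>A. cpd i (f a) z)) (at 0)"
    if "z \<in> S" for z i
    by (intro DERIV_sum sep_hol_DERIV0[OF assms that])
  note d = this
  have c: "continuous_on S (\<lambda>z. \<Sum>a\<in>A. f a z)"
    by (intro continuous_intros sep_hol_continuous_on assms)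
  show "sep_hol S (\<lambda>z. \<Sum>a\<in>A. f a z)"
     "z \<in> S \<Longrightarrow> cpd i (\<lambda>z. \<Sum>a\<in>A. f a z) z = (\<Sum>a\<in>A. cpd i (f a) z)"
    using sep_holI[OF c d] by blast+
qed

lemma sep_hol_prod:
  "(\<And>a. a \<in> A \<Longrightarrow> sep_hol S (f a)) \<Longrightarrow> sep_hol S (\<lambda>z. \<Prod>a\<in>A. f a z)"
  by (induction A rule: infinite_finite_induct) (auto intro: sep_hol_const sep_hol_mult)

lemma sep_hol_det:
  assumes "\<And>i j. sep_hol S (\<lambda>z. M z $ i $ j)"
  shows "sep_hol S (\<lambda>z. det (M z))"
  unfolding det_def by (intro sep_hol_sum sep_hol_mult sep_hol_const sep_hol_prod assms)

section \<open>Uniform Taylor estimates and limits of difference quotients\<close>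

text \<open>Cauchy's inequality on circles of radius \<open>r\<close> around the points of
  \<open>ball 0 r\<close> bounds the second derivative; these circles stay within distance
  \<open>2 * r\<close> of 0, safely inside the domain.\<close>

lemma holomorphic_taylor1:
  fixes g :: "complex \<Rightarrow> complex"
  assumes r: "0 < r" and g: "g holomorphic_on ball 0 (3 * r)"
    and M: "\<And>t. norm t < 3 * r \<Longrightarrow> norm (g t) \<le> M" and h: "norm h < r"
  shows "norm (g h - g 0 - h * deriv g 0) \<le> 2 * M / r\<^sup>2 * (norm h)\<^sup>2"
proof -
  have B: "norm ((deriv ^^ 2) g t) \<le> 2 * M / r\<^sup>2" if "t \<in> ball 0 r" for t
  proof -
    have sub: "cball t r \<subseteq> ball 0 (3 * r)"
    proof
      fix w assume "w \<in> cball t r"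
      thus "w \<in> ball 0 (3 * r)"
        using that r norm_triangle_sub[of w t] by (simp add: dist_norm norm_minus_commute)
    qed
    have sub': "ball t r \<subseteq> ball 0 (3 * r)" using sub ball_subset_cball by blast
    have "norm ((deriv ^^ 2) g t) \<le> fact 2 * M / r^2"
    proof (rule Cauchy_inequality[OF holomorphic_on_subset[OF g sub'] _ r])
      show "continuous_on (cball t r) g"
        using holomorphic_on_imp_continuous_on[OF g] sub continuous_on_subset by blast
      fix w assume "norm (t - w) = r"
      hence "w \<in> cball t r" by (simp add: dist_norm)
      thus "norm (g w) \<le> M" using sub M by fastforce
    qed
    thus ?thesis by (simp add: eval_nat_numeral)
  qed
  have "norm ((deriv ^^ 0) g h - (\<Sum>i\<le>1. (deriv ^^ i) g 0 * (h - 0) ^ i / fact i))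
      \<le> 2 * M / r\<^sup>2 * norm (h - 0) ^ Suc 1 / fact 1"
  proof (rule complex_Taylor[where S = "ball 0 r"])
    fix i :: nat and t :: complex
    assume "t \<in> ball 0 r"
    hence "t \<in> ball 0 (3 * r)" using r by auto
    hence "((deriv ^^ i) g has_field_derivative (deriv ^^ Suc i) g t) (at t)"
      using g has_field_derivative_higher_deriv by blast
    thus "((deriv ^^ i) g has_field_derivative (deriv ^^ Suc i) g t) (at t within ball 0 r)"
      by (rule has_field_derivative_at_within)
  qed (use h r B in \<open>auto simp: numeral_2_eq_2\<close>)
  thus ?thesis by (simp add: algebra_simps power2_eq_square)
qed

text \<open>The constant is uniform in the base point \<open>z\<close>; this makes difference
  quotients converge uniformly and not just pointwise.\<close>

lemma sep_hol_taylor1: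
  fixes f :: "complex ^ 'n \<Rightarrow> complex"
  assumes S: "open S" and f: "sep_hol S f" and z0: "z0 \<in> S"
  obtains r C where "0 < r" "0 \<le> C"
    "\<And>z i h. z \<in> ball z0 r \<Longrightarrow> norm h < r \<Longrightarrow> z + h *s axis i 1 \<in> S \<and>
      norm (f (z + h *s axis i 1) - f z - h * cpd i f z) \<le> C * (norm h)\<^sup>2"
proof -
  obtain e where e: "0 < e" "cball z0 e \<subseteq> S" using S z0 open_contains_cball by blast
  \<comment> \<open>A base point within \<open>r\<close> of \<open>z0\<close> and a displacement
    below \<open>3 * r\<close>, the radius required by \<open>holomorphic_taylor1\<close>, together
    stay within \<open>e\<close>.\<close>
  define r where "r = e / 4"
  have "compact (f ` cball z0 e)"
    using sep_hol_continuous_on[OF f] e by (intro compact_continuous_image) (auto intro: continuous_on_subset)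
  then obtain M where M: "\<And>y. y \<in> cball z0 e \<Longrightarrow> norm (f y) \<le> M"
    using compact_imp_bounded[of "f ` cball z0 e"] unfolding bounded_iff by blast
  have M0: "0 \<le> M" using M[of z0] e norm_ge_zero[of "f z0"] by (simp del: norm_ge_zero)
  have in_cball: "z + t *s axis i 1 \<in> cball z0 e" if "z \<in> ball z0 r" "norm t < 3 * r" for z t and i :: 'n
  proof -
    have "norm ((z - z0) + t *s axis i 1) \<le> norm (z - z0) + norm t"
      using norm_triangle_ineq[of "z - z0" "t *s axis i 1"] by simp
    also have "\<dots> \<le> e" using that by (simp add: r_def dist_norm norm_minus_commute)
    finally show ?thesis by (simp add: dist_norm norm_minus_commute algebra_simps)
  qed
  have "z + h *s axis i 1 \<in> S \<and>
      norm (f (z + h *s axis i 1) - f z - h * cpd i f z) \<le> 2 * M / r\<^sup>2 * (norm h)\<^sup>2"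
    if z: "z \<in> ball z0 r" and h: "norm h < r" for z i h
  proof
    show "z + h *s axis i 1 \<in> S" using in_cball[OF z, of h i] h e r_def by auto
    have "(\<lambda>t. f (z + t *s axis i 1)) holomorphic_on ball 0 (3 * r)"
      unfolding holomorphic_on_open[OF open_ball]
    proof (intro ballI exI)
      fix t :: complex assume "t \<in> ball 0 (3 * r)"
      hence "z + t *s axis i 1 \<in> S" using in_cball[OF z, of t i] e(2) by auto
      thus "((\<lambda>t. f (z + t *s axis i 1)) has_field_derivative cpd i f (z + t *s axis i 1)) (at t)"
        by (rule sep_hol_DERIV[OF f])
    qed
    from holomorphic_taylor1[OF _ this, of M h]
    show "norm (f (z + h *s axis i 1) - f z - h * cpd i f z) \<le> 2 * M / r\<^sup>2 * (norm h)\<^sup>2"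
      using M in_cball[OF z] h e(1) by (simp add: cpd_def r_def)
  qed
  moreover have "0 < r" "0 \<le> 2 * M / r\<^sup>2" using e M0 by (auto simp: r_def)
  ultimately show ?thesis using that by blast
qed

text \<open>Weierstrass' convergence theorem, applied on a disc in each coordinate line.\<close>

lemma
  fixes f :: "nat \<Rightarrow> complex ^ 'n \<Rightarrow> complex"
  assumes S: "open S" and f: "\<And>n. sep_hol S (f n)" and lim: "uniform_limit S f g sequentially"
  shows sep_hol_uniform_limit: "sep_hol S g"
    and cpd_uniform_limit: "z \<in> S \<Longrightarrow> (\<lambda>n. cpd i (f n) z) \<longlonglongrightarrow> cpd i g z"
proof -
  have *: "\<exists>g'. ((\<lambda>t. g (z + t *s axis i 1)) has_field_derivative g') (at 0) \<and>
      (\<lambda>n. cpd i (f n) z) \<longlonglongrightarrow> g'" if z: "z \<in> S" for z i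
  proof -
    have "0 \<in> {t. z + t *s axis i 1 \<in> S}" using z by simp
    then obtain r where r: "0 < r" "cball 0 r \<subseteq> {t. z + t *s axis i 1 \<in> S}"
      using slice_open[OF S, of z i, unfolded open_contains_cball] by blast
    have ev: "\<forall>\<^sub>F n in sequentially. continuous_on (cball 0 r) (\<lambda>t. f n (z + t *s axis i 1)) \<and>
      (\<forall>w\<in>ball 0 r. ((\<lambda>t. f n (z + t *s axis i 1)) has_field_derivative
          cpd i (f n) (z + w *s axis i 1)) (at w))"
    proof (intro always_eventually allI conjI ballI)
      fix n
      show "continuous_on (cball 0 r) (\<lambda>t. f n (z + t *s axis i 1))"
        by (rule continuous_on_compose2[OF sep_hol_continuous_on[OF f]])
           (use r(2) in \<open>auto intro!: continuous_intros\<close>)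
      fix w :: complex assume "w \<in> ball 0 r"
      hence "z + w *s axis i 1 \<in> S" using r(2) ball_subset_cball by blast
      thus "((\<lambda>t. f n (z + t *s axis i 1)) has_field_derivative cpd i (f n) (z + w *s axis i 1)) (at w)"
        by (rule sep_hol_DERIV[OF f])
    qed
    have ul: "uniform_limit (cball 0 r) (\<lambda>n t. f n (z + t *s axis i 1))
        (\<lambda>t. g (z + t *s axis i 1)) sequentially"
      unfolding uniform_limit_iff
    proof (intro allI impI)
      fix e :: real assume "e > 0"
      hence "\<forall>\<^sub>F n in sequentially. \<forall>y\<in>S. dist (f n y) (g y) < e"
        using lim unfolding uniform_limit_iff by blast
      thus "\<forall>\<^sub>F n in sequentially. \<forall>t\<in>cball 0 r. dist (f n (z + t *s axis i 1)) (g (z + t *s axis i 1)) < e"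
        by eventually_elim (use r(2) in blast)
    qed
    show ?thesis
    proof (rule has_complex_derivative_uniform_limit[OF ev ul _ r(1)])
      fix g'
      assume "\<And>w. w \<in> ball 0 r \<Longrightarrow>
        ((\<lambda>t. g (z + t *s axis i 1)) has_field_derivative g' w) (at w) \<and>
        (\<lambda>n. cpd i (f n) (z + w *s axis i 1)) \<longlonglongrightarrow> g' w"
      from this[of 0] r(1) show ?thesis by auto
    qed auto
  qed
  have c: "continuous_on S g"
    by (rule uniform_limit_theorem[OF _ lim]) (use f in \<open>auto simp: sep_hol_def\<close>)
  show "sep_hol S g" using c * by (auto simp: sep_hol_def field_differentiable_def)
  assume "z \<in> S"
  from *[OF this, of i] obtain g' where
    "((\<lambda>t. g (z + t *s axis i 1)) has_field_derivative g') (at 0)"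
    and lim: "(\<lambda>n. cpd i (f n) z) \<longlonglongrightarrow> g'" by blast
  from DERIV_imp_deriv[OF this(1)] lim show "(\<lambda>n. cpd i (f n) z) \<longlonglongrightarrow> cpd i g z"
    by (simp add: cpd_def)
qed

lemma
  assumes f: "sep_hol S f" and T: "\<And>z. z \<in> T \<Longrightarrow> z + a \<in> S"
  shows sep_hol_shift: "sep_hol T (\<lambda>z. f (z + a))"
    and cpd_shift: "z \<in> T \<Longrightarrow> cpd i (\<lambda>z. f (z + a)) z = cpd i f (z + a)"
proof -
  have c: "continuous_on T (\<lambda>z. f (z + a))"
    using T by (intro continuous_on_compose2[OF sep_hol_continuous_on[OF f]] continuous_intros) auto
  have d: "((\<lambda>t. f (z + t *s axis i 1 + a)) has_field_derivative cpd i f (z + a)) (at 0)"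
    if "z \<in> T" for z i
    using sep_hol_DERIV0[OF f T[OF that], of i] by (simp add: add_ac)
  show "sep_hol T (\<lambda>z. f (z + a))" "z \<in> T \<Longrightarrow> cpd i (\<lambda>z. f (z + a)) z = cpd i f (z + a)"
    using sep_holI[OF c d] by blast+
qed

text \<open>The quotients are themselves separately holomorphic and converge uniformly to
  \<open>cpd i f\<close>, so Weierstrass' theorem passes their regularity on to the derivative. The
  last clause serves the symmetry of mixed derivatives.\<close>

lemma difference_quotients:
  fixes f :: "complex ^ 'n \<Rightarrow> complex"
  assumes S: "open S" and f: "sep_hol S f" and z0: "z0 \<in> S"
  obtains U :: "(complex ^ 'n) set" and h :: "nat \<Rightarrow> complex" and Q where
    "open U" "z0 \<in> U" "\<And>n. sep_hol U (Q n)" "uniform_limit U Q (cpd i f) sequentially"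
    "h \<longlonglongrightarrow> 0" "\<And>n. h n \<noteq> 0"
    "\<And>n j. cpd j (Q n) z0 = (cpd j f (z0 + h n *s axis i 1) - cpd j f z0) / h n"
proof -
  obtain r C where r: "0 < r" "0 \<le> C"
    and C: "\<And>z i h. z \<in> ball z0 r \<Longrightarrow> norm h < r \<Longrightarrow> z + h *s axis i 1 \<in> S \<and>
      norm (f (z + h *s axis i 1) - f z - h * cpd i f z) \<le> C * (norm h)\<^sup>2"
    using sep_hol_taylor1[OF assms] by blast
  \<comment> \<open>The denominator \<open>n + 2\<close> keeps every step strictly below
    \<open>r\<close>, also for \<open>n = 0\<close>.\<close>
  define h :: "nat \<Rightarrow> complex" where "h = (\<lambda>n. of_real (r / real (n + 2)))"
  define Q where "Q = (\<lambda>n z. (f (z + h n *s axis i 1) - f z) / h n)"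
  have h: "h n \<noteq> 0" "norm (h n) < r" for n
  proof -
    have "0 < r / real (n + 2)" "r / real (n + 2) < r / 1"
      using r by (intro divide_pos_pos divide_strict_left_mono; simp)+
    thus "h n \<noteq> 0" "norm (h n) < r"
      unfolding h_def norm_of_real of_real_eq_0_iff by simp_all
  qed
  have "(\<lambda>n. r / real (n + 2)) \<longlonglongrightarrow> 0"
    using LIMSEQ_ignore_initial_segment[OF lim_const_over_n, of r 2] by simp
  hence h0: "h \<longlonglongrightarrow> 0" unfolding h_def by (metis of_real_0 tendsto_of_real)
  have sub: "ball z0 r \<subseteq> S" using C[of _ 0] r by auto
  have sh: "sep_hol (ball z0 r) (\<lambda>z. f (z + h n *s axis i 1))" for n
    using C h by (intro sep_hol_shift[OF f]) blast
  note fb = sep_hol_subset[OF f sub]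
  have Q: "sep_hol (ball z0 r) (Q n)" for n
    unfolding Q_def using h by (intro sep_hol_divide sep_hol_diff sh fb sep_hol_const)
  have cQ: "cpd j (Q n) z0 = (cpd j f (z0 + h n *s axis i 1) - cpd j f z0) / h n" for n j
  proof -
    have "Q n = (\<lambda>z. inverse (h n) * (f (z + h n *s axis i 1) - f z))"
      by (simp add: Q_def field_simps)
    hence "cpd j (Q n) z0 = inverse (h n) * (cpd j f (z0 + h n *s axis i 1) - cpd j f z0)"
      using cpd_mult[OF sep_hol_const sep_hol_diff[OF sh fb], of z0] cpd_diff[OF sh fb, of z0]
        cpd_shift[OF f, of "{z0}"] r C[of z0 "h n"] h(2)
      by (simp add: cpd_const)
    thus ?thesis by (simp add: field_simps)
  qed
  have le: "norm (Q n z - cpd i f z) \<le> C * norm (h n)" if "z \<in> ball z0 r" for n z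
  proof -
    have "Q n z - cpd i f z = (f (z + h n *s axis i 1) - f z - h n * cpd i f z) / h n"
      using h(1)[of n] by (simp add: Q_def field_simps)
    also have "norm \<dots> \<le> C * (norm (h n))\<^sup>2 / norm (h n)"
      unfolding norm_divide using C[OF that h(2)] by (intro divide_right_mono) auto
    finally show ?thesis using h(1)[of n] by (simp add: power2_eq_square)
  qed
  have lim: "(\<lambda>n. C * norm (h n)) \<longlonglongrightarrow> 0"
    using tendsto_mult[OF tendsto_const[of C] tendsto_norm[OF h0]] by simp
  have "uniform_limit (ball z0 r) Q (cpd i f) sequentially"
    unfolding uniform_limit_iff dist_norm
  proof (intro allI impI)
    fix e :: real assume "0 < e"
    from order_tendstoD(2)[OF lim \<open>0 < e\<close>]
    show "\<forall>\<^sub>F n in sequentially. \<forall>z\<in>ball z0 r. norm (Q n z - cpd i f z) < e"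
      by eventually_elim (use le in \<open>blast intro: le_less_trans\<close>)
  qed
  thus ?thesis
    using that[of "ball z0 r" Q h] Q h h0 cQ r(1) by auto
qed

lemma sep_hol_cpd:
  assumes "open S" "sep_hol S f"
  shows "sep_hol S (cpd i f)"
proof (rule sep_hol_local)
  fix z assume "z \<in> S"
  show "\<exists>U. open U \<and> z \<in> U \<and> sep_hol U (cpd i f)"
  proof (rule difference_quotients[OF assms \<open>z \<in> S\<close>, of i])
    fix U :: "(complex ^ 'a) set" and Q
    assume U: "open U" "z \<in> U" and Q: "\<And>n. sep_hol U (Q n)" "uniform_limit U Q (cpd i f) sequentially"
    show ?thesis using U sep_hol_uniform_limit[OF U(1) Q] by blast
  qed
qed

text \<open>Applied to the quotients in direction \<open>i\<close>, \<open>cpd j\<close> has two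
  limits: \<open>cpd j (cpd i f) z\<close> by uniform convergence, and
  \<open>cpd i (cpd j f) z\<close> because it yields a difference quotient of
  \<open>cpd j f\<close>.\<close>

lemma cpd_commute:
  assumes "open S" "sep_hol S f" "z \<in> S"
  shows "cpd i (cpd j f) z = cpd j (cpd i f) z"
proof (rule difference_quotients[OF assms, of i])
  fix U h Q
  assume U: "open U" "z \<in> U" and Q: "\<And>n. sep_hol U (Q n)"
    "uniform_limit U Q (cpd i f) sequentially"
    and h: "h \<longlonglongrightarrow> 0" "\<And>n. h n \<noteq> 0"
    and c: "\<And>n j. cpd j (Q n) z = (cpd j f (z + h n *s axis i 1) - cpd j f z) / h n"
  have "(\<lambda>n. cpd j (Q n) z) \<longlonglongrightarrow> cpd j (cpd i f) z"
    by (rule cpd_uniform_limit[OF U(1) Q U(2)])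
  moreover have "((\<lambda>t. (cpd j f (z + t *s axis i 1) - cpd j f z) / t) \<longlongrightarrow> cpd i (cpd j f) z) (at 0)"
    using sep_hol_DERIV0[OF sep_hol_cpd[OF assms(1,2)] assms(3)] by (simp add: DERIV_def)
  hence "(\<lambda>n. cpd j (Q n) z) \<longlonglongrightarrow> cpd i (cpd j f) z"
    unfolding c by (rule filterlim_compose) (use h in \<open>auto simp: filterlim_at\<close>)
  ultimately show ?thesis using LIMSEQ_unique by blast
qed

text \<open>Coordinates are switched on one at a time. Each new one adds an increment
  \<open>D\<close>, compared with its linear part by the mean value inequality and the continuity of
  \<open>cpd i f\<close>.\<close>

theorem osgood:
  fixes f :: "complex ^ 'n \<Rightarrow> complex"
  assumes S: "open S" and f: "sep_hol S f" and z: "z \<in> S"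
  shows "(f has_derivative (\<lambda>h. \<Sum>i\<in>UNIV. cpd i f z * h $ i)) (at z)"
proof -
  define R :: "'n set \<Rightarrow> complex ^ 'n \<Rightarrow> complex ^ 'n" where
    "R = (\<lambda>I h. \<chi> i. if i \<in> I then h $ i else 0)"
  have R: "norm (R I h) \<le> norm h" for I h
    by (rule norm_le_componentwise_cart) (auto simp: R_def)
  have "((\<lambda>h. f (z + R I h)) has_derivative (\<lambda>h. \<Sum>i\<in>I. cpd i f z * h $ i)) (at 0)"
    if "finite I" for I
    using that
  proof induction
    case empty
    then show ?case by (simp add: R_def)
  next
    case (insert i I)
    define D where "D = (\<lambda>h. f (z + R I h + (h $ i) *s axis i 1) - f (z + R I h))"
    have "(D has_derivative (\<lambda>h. cpd i f z * h $ i)) (at 0)"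
      unfolding has_derivative_at_alt
    proof (intro conjI allI impI)
      show "bounded_linear (\<lambda>h. cpd i f z * h $ i)"
        by (intro bounded_linear_const_mult bounded_linear_vec_nth)
      fix e :: real assume e: "0 < e"
      have "isCont (cpd i f) z"
        using sep_hol_continuous_on[OF sep_hol_cpd[OF S f]] S z continuous_on_eq_continuous_at by blast
      then obtain d1 where d1: "0 < d1" "\<And>y. dist y z < d1 \<Longrightarrow> dist (cpd i f y) (cpd i f z) < e"
        using e unfolding continuous_at_eps_delta by blast
      obtain d2 where d2: "0 < d2" "ball z d2 \<subseteq> S" using S z open_contains_ball by blast
      \<comment> \<open>Halved because the points used below are displaced from \<open>z\<close> by
        \<open>R I h\<close> and by a further multiple of \<open>axis i 1\<close>, each of norm at
        most \<open>norm h\<close>.\<close>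
      define d where "d = min d1 d2 / 2"
      show "\<exists>d>0. \<forall>y. norm (y - 0) < d \<longrightarrow>
          norm (D y - D 0 - cpd i f z * (y - 0) $ i) \<le> e * norm (y - 0)"
      proof (intro exI[of _ d] conjI allI impI)
        show "0 < d" using d1 d2 by (simp add: d_def)
        fix h :: "complex ^ 'n" assume h: "norm (h - 0) < d"
        define y where "y = z + R I h"
        have hi: "norm (h $ i) \<le> norm h" by (rule Finite_Cartesian_Product.norm_nth_le)
        have near: "dist (y + t *s axis i 1) z < 2 * d" if "t \<in> cball 0 (norm (h $ i))" for t :: complex
        proof -
          have "norm (R I h + t *s axis i 1) \<le> norm (R I h) + norm t"
            using norm_triangle_ineq[of "R I h" "t *s axis i 1"] by simp
          thus ?thesis using that R[of I h] h hi by (simp add: y_def dist_norm add.assoc)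
        qed
        \<comment> \<open>With the linear part subtracted, the function of \<open>t\<close> has
          derivative at most \<open>e\<close> in norm.\<close>
        have "norm ((f (y + (h $ i) *s axis i 1) - (h $ i) * cpd i f z) - (f (y + 0 *s axis i 1) - 0 * cpd i f z))
            \<le> e * norm (h $ i - 0)"
        proof (rule field_differentiable_bound[where S = "cball 0 (norm (h $ i))"
              and f' = "\<lambda>t. cpd i f (y + t *s axis i 1) - cpd i f z"])
          fix t :: complex assume t: "t \<in> cball 0 (norm (h $ i))"
          have "y + t *s axis i 1 \<in> S"
            using near[OF t] d2 by (auto simp: d_def dist_commute subset_iff)
          thus "((\<lambda>t. f (y + t *s axis i 1) - t * cpd i f z) has_field_derivative
              cpd i f (y + t *s axis i 1) - cpd i f z) (at t within cball 0 (norm (h $ i)))"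
            by (intro DERIV_diff[THEN has_field_derivative_at_within] sep_hol_DERIV[OF f])
               (auto intro!: derivative_eq_intros)
          show "norm (cpd i f (y + t *s axis i 1) - cpd i f z) \<le> e"
            using d1(2)[of "y + t *s axis i 1"] near[OF t] by (simp add: d_def dist_norm)
        qed auto
        also have "\<dots> \<le> e * norm h" using e hi by simp
        finally have "norm ((f (y + (h $ i) *s axis i 1) - (h $ i) * cpd i f z) - (f (y + 0 *s axis i 1) - 0 * cpd i f z))
            \<le> e * norm h" .
        moreover have "R I 0 = 0" by (simp add: R_def vec_eq_iff)
        ultimately show "norm (D h - D 0 - cpd i f z * (h - 0) $ i) \<le> e * norm (h - 0)"
          by (simp add: D_def y_def algebra_simps)
      qed
    qed
    from has_derivative_add[OF this insert.IH]
    have "((\<lambda>h. D h + f (z + R I h)) has_derivative (\<lambda>h. \<Sum>i\<in>insert i I. cpd i f z * h $ i)) (at 0)"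
      using insert.hyps by simp
    moreover have "R (insert i I) h = R I h + (h $ i) *s axis i 1" for h
      using insert.hyps by (auto simp: R_def vec_eq_iff axis_def)
    hence "D h + f (z + R I h) = f (z + R (insert i I) h)" for h by (simp add: D_def add.assoc)
    ultimately show ?case by simp
  qed
  from this[of UNIV] have "((\<lambda>h. f (z + h)) has_derivative (\<lambda>h. \<Sum>i\<in>UNIV. cpd i f z * h $ i)) (at (z - z))"
    by (simp add: R_def)
  from has_derivative_compose[of "\<lambda>y. y - z" "\<lambda>h. h" z UNIV, OF _ this]
  show ?thesis by (simp add: has_derivative_diff[OF has_derivative_ident has_derivative_const, simplified])
qed

section \<open>Pfaffian systems\<close>

lemma sep_hol_line:
  fixes f :: "complex ^ 'n \<Rightarrow> complex"
  assumes S: "open S" and f: "sep_hol S f" and t: "a + t *s v \<in> S"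
  shows "((\<lambda>t. f (a + t *s v)) has_field_derivative (\<Sum>i\<in>UNIV. v $ i * cpd i f (a + t *s v))) (at t)"
proof -
  have l: "bounded_linear (\<lambda>t :: complex. t *s v)"
  proof (rule bounded_linear_intro)
    show "norm (t *s v) \<le> norm t * norm v" for t by (simp add: norm_vector_scalar_mult)
  qed (auto simp: vec_eq_iff algebra_simps)
  have "((\<lambda>t. a + t *s v) has_derivative (\<lambda>t. t *s v)) (at t)"
    using has_derivative_add[OF has_derivative_const bounded_linear.has_derivative[OF l has_derivative_ident]]
    by simp
  from has_derivative_compose[OF this osgood[OF S f t]]
  have "((\<lambda>t. f (a + t *s v)) has_derivative (\<lambda>h. \<Sum>i\<in>UNIV. cpd i f (a + t *s v) * (h * v $ i))) (at t)"
    by simp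
  moreover have "(\<lambda>h. \<Sum>i\<in>UNIV. cpd i f (a + t *s v) * (h * v $ i))
      = (*) (\<Sum>i\<in>UNIV. v $ i * cpd i f (a + t *s v))"
    by (simp add: sum_distrib_left mult_ac fun_eq_iff)
  ultimately show ?thesis by (simp add: has_field_derivative_def)
qed

text \<open>The interior of the coincidence set is closed in \<open>V\<close>: a ball in
  \<open>V\<close> that meets it lies inside it, since a complex line joins any point of the ball to
  a point of the interior, and on it the one-variable theorem applies.\<close>

lemma identity_theorem:
  fixes f g :: "complex ^ 'n \<Rightarrow> complex"
  assumes V: "open V" "connected V" and f: "sep_hol V f" and g: "sep_hol V g"
    and U: "open U" "U \<noteq> {}" "U \<subseteq> V" and eq: "\<And>z. z \<in> U \<Longrightarrow> f z = g z" and z: "z \<in> V"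
  shows "f z = g z"
proof -
  define A where "A = interior {z \<in> V. f z = g z}"
  have A: "open A" "A \<subseteq> V" "\<And>z. z \<in> A \<Longrightarrow> f z = g z"
    using interior_subset[of "{z \<in> V. f z = g z}"] by (auto simp: A_def)
  have "U \<subseteq> A" unfolding A_def using U eq by (intro interior_maximal) auto
  have key: "ball z \<rho> \<subseteq> A" if sub: "ball z \<rho> \<subseteq> V" and y: "y \<in> A" "y \<in> ball z \<rho>" for z \<rho> y
    unfolding A_def
  proof (rule interior_maximal)
    show "ball z \<rho> \<subseteq> {z \<in> V. f z = g z}"
    proof safe
      fix w assume w: "w \<in> ball z \<rho>"
      thus "w \<in> V" using sub by blast
      define L where "L = (\<lambda>t. y + t *s (w - y))"
      \<comment> \<open>Convexity of the ball makes this parameter set convex, hence connected; it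
        contains 0, where the line is at \<open>y\<close>, and 1, where it reaches
        \<open>w\<close>.\<close>
      define T where "T = {t. L t \<in> ball z \<rho>}"
      have cL: "continuous_on UNIV L" unfolding L_def by (intro continuous_intros)
      have oT: "open T" "open {t \<in> T. L t \<in> A}"
        using open_vimage[OF open_ball cL] open_vimage[OF open_Int[OF open_ball A(1)] cL]
        by (auto simp: T_def vimage_def)
      have "convex T"
      proof (rule convexI)
        fix s t :: complex and u v :: real
        assume st: "s \<in> T" "t \<in> T" "0 \<le> u" "0 \<le> v" "u + v = 1"
        have u: "u = 1 - v" using st by simp
        have "L (u *\<^sub>R s + v *\<^sub>R t) = u *\<^sub>R L s + v *\<^sub>R L t"
          by (simp add: L_def u vec_eq_iff scaleR_conv_of_real[where 'a = complex] algebra_simps)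
        thus "u *\<^sub>R s + v *\<^sub>R t \<in> T"
          using st convexD[OF convex_ball, of "L s" z \<rho> "L t" u v] by (simp add: T_def)
      qed
      have "f (L 1) = g (L 1)"
      proof (rule analytic_continuation_open[of "{t \<in> T. L t \<in> A}" T
            "\<lambda>t. f (L t)" "\<lambda>t. g (L t)" 1])
        have "0 \<in> {t \<in> T. L t \<in> A}" using y by (simp add: T_def L_def)
        thus "{t \<in> T. L t \<in> A} \<noteq> {}" by blast
        show "connected T" by (rule convex_connected[OF \<open>convex T\<close>])
        show "1 \<in> T" using w by (simp add: T_def L_def)
        have LV: "L t \<in> V" if "t \<in> T" for t using that sub by (auto simp: T_def)
        have "\<exists>d. ((\<lambda>t. f (L t)) has_field_derivative d) (at t)" if "t \<in> T" for t
          using sep_hol_line[OF V(1) f LV[OF that, unfolded L_def]] unfolding L_def by blast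
        thus "(\<lambda>t. f (L t)) holomorphic_on T" by (simp add: holomorphic_on_open oT)
        have "\<exists>d. ((\<lambda>t. g (L t)) has_field_derivative d) (at t)" if "t \<in> T" for t
          using sep_hol_line[OF V(1) g LV[OF that, unfolded L_def]] unfolding L_def by blast
        thus "(\<lambda>t. g (L t)) holomorphic_on T" by (simp add: holomorphic_on_open oT)
      qed (use oT A in auto)
      thus "f w = g w" by (simp add: L_def)
    qed
  qed simp
  have "open (V - A)"
    unfolding open_contains_ball
  proof
    fix z assume z: "z \<in> V - A"
    then obtain \<rho> where "0 < \<rho>" "ball z \<rho> \<subseteq> V" using V(1) open_contains_ball by blast
    moreover have "ball z \<rho> \<inter> A = {}"
    proof (rule ccontr)
      assume "ball z \<rho> \<inter> A \<noteq> {}"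
      then obtain y where "y \<in> A" "y \<in> ball z \<rho>" by blast
      from key[OF \<open>ball z \<rho> \<subseteq> V\<close> this] z centre_in_ball[of z \<rho>] \<open>0 < \<rho>\<close> show False by blast
    qed
    ultimately show "\<exists>e>0. ball z e \<subseteq> V - A" by blast
  qed
  from connectedD[OF V(2) A(1) this] have "A \<inter> V = {} \<or> (V - A) \<inter> V = {}" by blast
  thus ?thesis using \<open>U \<subseteq> A\<close> U A z by blast
qed

section \<open>Integration along segments and Picard iteration\<close>

lemma segment_in_convex:
  assumes "convex D" "z0 \<in> D" "z \<in> D" "t \<in> {0..1}"
  shows "z0 + t *\<^sub>R (z - z0) \<in> D"
  using convexD_alt[OF assms(1-3), of t] assms(4) by (simp add: algebra_simps)

text \<open>Differentiation under the integral sign. Moving the endpoint by \<open>s\<close> moves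
  the point at time \<open>t\<close> by \<open>t * s\<close>, hence the factor \<open>t\<close> in
  the derivative.\<close>

lemma sep_hol_segment_integral:
  fixes g :: "complex ^ 'n \<Rightarrow> complex"
  assumes S: "open S" "convex S" "z0 \<in> S" and g: "sep_hol S g"
  shows "sep_hol S (\<lambda>z. integral {0..1} (\<lambda>t. g (z0 + t *\<^sub>R (z - z0))))"
  unfolding sep_hol_def
proof (intro conjI ballI allI)
  have seg: "z0 + t *\<^sub>R (z - z0) \<in> S" if "z \<in> S" "t \<in> {0..1}" for z t
    by (rule segment_in_convex[OF S(2,3) that])
  have cg: "continuous_on (S \<times> {0..1}) (\<lambda>(z, t). h (z0 + t *\<^sub>R (z - z0)))"
    if "continuous_on S h" for h :: "complex ^ 'n \<Rightarrow> complex"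
    unfolding split_beta
    by (rule continuous_on_compose2[OF that]) (use seg in \<open>auto intro!: continuous_intros\<close>)
  show "continuous_on S (\<lambda>z. integral {0..1} (\<lambda>t. g (z0 + t *\<^sub>R (z - z0))))"
    using integral_continuous_on_param[of S 0 1 "\<lambda>z t. g (z0 + t *\<^sub>R (z - z0))"]
      cg[OF sep_hol_continuous_on[OF g]] by simp
  fix z :: "complex ^ 'n" and i :: 'n assume z: "z \<in> S"
  have "0 \<in> {s. z + s *s axis i 1 \<in> S}" using z by simp
  then obtain r where r: "0 < r" "ball 0 r \<subseteq> {s. z + s *s axis i 1 \<in> S}"
    using slice_open[OF S(1), of z i, unfolded open_contains_ball] by blast
  have rS: "z + s *s axis i 1 \<in> S" if "s \<in> ball 0 r" for s using r that by blast
  have shift: "z0 + t *\<^sub>R (z + s *s axis i 1 - z0) = (z0 + t *\<^sub>R (z - z0)) + (of_real t * s) *s axis i 1"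
    for s t by (simp add: vec_eq_iff scaleR_conv_of_real[where 'a=complex] algebra_simps)
  have "(\<lambda>s. integral (cbox 0 1) (\<lambda>t. g (z0 + t *\<^sub>R (z + s *s axis i 1 - z0)))) holomorphic_on ball 0 r"
  proof (rule leibniz_rule_holomorphic[where fx = "\<lambda>s t. of_real t * cpd i g (z0 + t *\<^sub>R (z + s *s axis i 1 - z0))"])
    fix s :: complex and t :: real assume s: "s \<in> ball 0 r" and t: "t \<in> cbox 0 1"
    have "z0 + t *\<^sub>R (z + s *s axis i 1 - z0) \<in> S" using seg[OF rS[OF s], of t] t by simp
    hence *: "(z0 + t *\<^sub>R (z - z0)) + (of_real t * s) *s axis i 1 \<in> S" unfolding shift .
    have "((\<lambda>s. g ((z0 + t *\<^sub>R (z - z0)) + (of_real t * s) *s axis i 1)) has_field_derivative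
        cpd i g ((z0 + t *\<^sub>R (z - z0)) + (of_real t * s) *s axis i 1) * of_real t) (at s)"
      by (rule DERIV_chain2[where f = "\<lambda>\<tau>. g ((z0 + t *\<^sub>R (z - z0)) + \<tau> *s axis i 1)"
            and g = "\<lambda>s. of_real t * s", OF sep_hol_DERIV[OF g *]]) (auto intro!: derivative_eq_intros)
    thus "((\<lambda>s. g (z0 + t *\<^sub>R (z + s *s axis i 1 - z0))) has_field_derivative
        of_real t * cpd i g (z0 + t *\<^sub>R (z + s *s axis i 1 - z0))) (at s within ball 0 r)"
      unfolding shift by (subst mult.commute) (rule has_field_derivative_at_within)
  next
    fix s :: complex assume s: "s \<in> ball 0 r"
    show "(\<lambda>t. g (z0 + t *\<^sub>R (z + s *s axis i 1 - z0))) integrable_on cbox 0 1"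
      by (intro integrable_continuous continuous_on_compose2[OF sep_hol_continuous_on[OF g]] continuous_intros)
         (use seg[OF rS[OF s]] in auto)
  next
    show "continuous_on (ball 0 r \<times> cbox 0 1) (\<lambda>(s, t). of_real t * cpd i g (z0 + t *\<^sub>R (z + s *s axis i 1 - z0)))"
      unfolding split_beta
      by (intro continuous_on_mult continuous_on_of_real continuous_on_snd continuous_on_id
          continuous_on_compose2[OF sep_hol_continuous_on[OF sep_hol_cpd[OF S(1) g]]] continuous_intros)
         (use seg[OF rS] in auto)
  qed simp
  thus "(\<lambda>s. integral {0..1} (\<lambda>t. g (z0 + t *\<^sub>R (z + s *s axis i 1 - z0)))) field_differentiable (at 0)"
    using r by (simp add: holomorphic_on_imp_differentiable_at)
qed

text \<open>The right-hand side of the system integrated along the segment from \<open>z0\<close> to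
  \<open>z\<close>, plus the initial value \<open>c\<close>. On a convex open set every solution
  with this initial value is a fixed point, whether or not the coefficients satisfy a compatibility
  condition.\<close>

definition picard ::
  "('n::finite \<Rightarrow> 'm::finite \<Rightarrow> 'm \<Rightarrow> complex ^ 'n \<Rightarrow> complex) \<Rightarrow> complex ^ 'n \<Rightarrow> ('m \<Rightarrow> complex) \<Rightarrow>
    ('m \<Rightarrow> complex ^ 'n \<Rightarrow> complex) \<Rightarrow> 'm \<Rightarrow> complex ^ 'n \<Rightarrow> complex" where
  "picard a z0 c W b z = c b + (\<Sum>k\<in>UNIV. (z - z0) $ k *
     integral {0..1} (\<lambda>t. \<Sum>b'\<in>UNIV. a k b b' (z0 + t *\<^sub>R (z - z0)) * W b' (z0 + t *\<^sub>R (z - z0))))"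

lemma sep_hol_picard:
  assumes D: "open D" "convex D" "z0 \<in> D" and a: "\<And>k b b'. sep_hol D (a k b b')"
    and W: "\<And>b. sep_hol D (W b)"
  shows "sep_hol D (picard a z0 c W b)"
proof -
  have "sep_hol D (\<lambda>z. \<Sum>b'\<in>UNIV. a k b b' z * W b' z)" for k
    by (intro sep_hol_sum sep_hol_mult a W)
  hence "sep_hol D (\<lambda>z. integral {0..1} (\<lambda>t. \<Sum>b'\<in>UNIV. a k b b' (z0 + t *\<^sub>R (z - z0)) * W b' (z0 + t *\<^sub>R (z - z0))))" for k
    by (rule sep_hol_segment_integral[OF D])
  moreover have "sep_hol D (\<lambda>z. (z - z0) $ k)" for k
    unfolding vector_minus_component by (intro sep_hol_diff sep_hol_coord sep_hol_const)
  ultimately show ?thesis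
    unfolding picard_def by (intro sep_hol_add sep_hol_const sep_hol_sum sep_hol_mult)
qed

lemma segment_integrable:
  fixes f :: "complex ^ 'n \<Rightarrow> complex"
  assumes "convex D" "z0 \<in> D" "z \<in> D" "sep_hol D f"
  shows "(\<lambda>t. f (z0 + t *\<^sub>R (z - z0))) integrable_on {0..1}"
  by (intro integrable_continuous_interval continuous_on_compose2[OF sep_hol_continuous_on[OF assms(4)]]
      continuous_intros) (use segment_in_convex[OF assms(1-3)] in auto)

text \<open>There are \<open>CARD('n)\<close> integrals, each weighted by a coordinate of size at
  most \<open>r\<close> and containing \<open>CARD('m)\<close> terms with coefficients at most
  \<open>C\<close>; this is the product in the smallness condition.\<close>

lemma picard_contraction:
  fixes a :: "'n::finite \<Rightarrow> 'm::finite \<Rightarrow> 'm \<Rightarrow> complex ^ 'n \<Rightarrow> complex"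
    and C r K :: real
  assumes D: "convex D" "z0 \<in> D" and a: "\<And>k b b'. sep_hol D (a k b b')"
    and W: "\<And>b. sep_hol D (W b)" "\<And>b. sep_hol D (W' b)"
    and C: "\<And>k b b' z. z \<in> D \<Longrightarrow> norm (a k b b' z) \<le> C"
    and r: "\<And>z. z \<in> D \<Longrightarrow> norm (z - z0) \<le> r" "CARD('n) * r * (CARD('m) * C) \<le> 1/2"
    and K: "\<And>b z. z \<in> D \<Longrightarrow> norm (W b z - W' b z) \<le> K" and z: "z \<in> D"
  shows "norm (picard a z0 c W b z - picard a z0 c W' b z) \<le> K / 2"
proof -
  have C0: "0 \<le> C" using C[OF D(2)] norm_ge_zero order_trans by blast
  have K0: "0 \<le> K" using K[OF D(2)] norm_ge_zero order_trans by blast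
  have r0: "0 \<le> r" using r(1)[OF D(2)] by simp
  let ?g = "\<lambda>t. z0 + t *\<^sub>R (z - z0)"
  define I where "I = (\<lambda>W k. integral {0..1} (\<lambda>t. \<Sum>b'\<in>UNIV. a k b b' (?g t) * W b' (?g t)))"
  have sW: "sep_hol D (\<lambda>z. \<Sum>b'\<in>UNIV. a k b b' z * W b' z)" if "\<And>b. sep_hol D (W b)" for W k
    by (intro sep_hol_sum sep_hol_mult a that)
  have "norm (I W k - I W' k) \<le> CARD('m) * C * K" for k
  proof -
    have "I W k - I W' k = integral {0..1} (\<lambda>t. (\<Sum>b'\<in>UNIV. a k b b' (?g t) * W b' (?g t)) - (\<Sum>b'\<in>UNIV. a k b b' (?g t) * W' b' (?g t)))"
      unfolding I_def
      by (rule integral_diff[symmetric]; rule segment_integrable[OF D z sW]; fact)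
    also have "norm \<dots> \<le> CARD('m) * C * K * (1 - 0)"
    proof (rule integral_bound)
      show "continuous_on {0..1} (\<lambda>t. (\<Sum>b'\<in>UNIV. a k b b' (?g t) * W b' (?g t)) - (\<Sum>b'\<in>UNIV. a k b b' (?g t) * W' b' (?g t)))"
        by (intro continuous_on_compose2[OF sep_hol_continuous_on[OF sep_hol_diff[OF sW[OF W(1)] sW[OF W(2)]]]]
          continuous_intros) (use segment_in_convex[OF D z] in auto)
      fix t :: real assume "t \<in> {0..1}"
      from segment_in_convex[OF D z this] have g: "?g t \<in> D" .
      have "norm (\<Sum>b'\<in>UNIV. a k b b' (?g t) * (W b' (?g t) - W' b' (?g t))) \<le> (\<Sum>b'\<in>(UNIV :: 'm set). C * K)"
        by (intro order_trans[OF norm_sum] sum_mono, unfold norm_mult, intro mult_mono C K g norm_ge_zero C0)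
      thus "norm ((\<Sum>b'\<in>UNIV. a k b b' (?g t) * W b' (?g t)) - (\<Sum>b'\<in>UNIV. a k b b' (?g t) * W' b' (?g t))) \<le> CARD('m) * C * K"
        by (simp add: sum_subtractf right_diff_distrib)
    qed simp
    finally show ?thesis by simp
  qed
  moreover have "norm ((z - z0) $ k) \<le> r" for k
    using Finite_Cartesian_Product.norm_nth_le[of "z - z0" k] r(1)[OF z] by simp
  ultimately have "norm (\<Sum>k\<in>UNIV. (z - z0) $ k * (I W k - I W' k)) \<le> (\<Sum>k\<in>(UNIV :: 'n set). r * (CARD('m) * C * K))"
    by (intro order_trans[OF norm_sum] sum_mono, unfold norm_mult, intro mult_mono) (auto simp: r0)
  also have "\<dots> = (CARD('n) * r * (CARD('m) * C)) * K" by (simp add: mult_ac)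
  also have "\<dots> \<le> 1/2 * K" by (rule mult_right_mono[OF r(2) K0])
  also have "(\<Sum>k\<in>UNIV. (z - z0) $ k * (I W k - I W' k)) = picard a z0 c W b z - picard a z0 c W' b z"
    by (simp add: picard_def I_def sum_subtractf right_diff_distrib)
  finally show ?thesis by simp
qed

lemma picard_fixed:
  fixes a :: "'n::finite \<Rightarrow> 'm::finite \<Rightarrow> 'm \<Rightarrow> complex ^ 'n \<Rightarrow> complex"
  assumes D: "open D" "convex D" "z0 \<in> D" and a: "\<And>k b b'. sep_hol D (a k b b')"
    and h: "\<And>b. sep_hol D (h b)"
    and eq: "\<And>k b z. z \<in> D \<Longrightarrow> cpd k (h b) z = (\<Sum>b'\<in>UNIV. a k b b' z * h b' z)"
    and z: "z \<in> D"
  shows "picard a z0 (\<lambda>b. h b z0) h b z = h b z"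
proof -
  let ?g = "\<lambda>t. z0 + t *\<^sub>R (z - z0)"
  have gD: "?g t \<in> D" if "t \<in> {0..1}" for t by (rule segment_in_convex[OF D(2,3) z that])
  have scale: "t *\<^sub>R v = complex_of_real t *s v" for t and v :: "complex ^ 'n"
    by (simp add: vec_eq_iff scaleR_conv_of_real[where 'a = complex])
  have "((\<lambda>t. \<Sum>k\<in>UNIV. (z - z0) $ k * cpd k (h b) (?g t)) has_integral (h b (?g 1) - h b (?g 0))) {0..1}"
  proof (rule fundamental_theorem_of_calculus)
    fix t :: real assume "t \<in> {0..1}"
    from gD[OF this] have "z0 + complex_of_real t *s (z - z0) \<in> D" by (simp add: scale)
    from has_vector_derivative_real_field[OF sep_hol_line[OF D(1) h this]]
    show "((\<lambda>t. h b (?g t)) has_vector_derivative (\<Sum>k\<in>UNIV. (z - z0) $ k * cpd k (h b) (?g t))) (at t within {0..1})"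
      by (simp add: scale)
  qed simp
  hence "h b z - h b z0 = integral {0..1} (\<lambda>t. \<Sum>k\<in>UNIV. (z - z0) $ k * cpd k (h b) (?g t))"
    by (simp add: integral_unique)
  also have "\<dots> = (\<Sum>k\<in>UNIV. integral {0..1} (\<lambda>t. (z - z0) $ k * cpd k (h b) (?g t)))"
    by (intro integral_sum integrable_on_mult_right segment_integrable[OF D(2,3) z] sep_hol_cpd D h) simp
  also have "\<dots> = (\<Sum>k\<in>UNIV. (z - z0) $ k * integral {0..1} (\<lambda>t. cpd k (h b) (?g t)))"
    by simp
  also have "\<dots> = (\<Sum>k\<in>UNIV. (z - z0) $ k * integral {0..1} (\<lambda>t. \<Sum>b'\<in>UNIV. a k b b' (?g t) * h b' (?g t)))"
    by (intro sum.cong refl arg_cong2[where f = "(*)"] integral_cong) (use gD eq in auto)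
  finally show ?thesis by (simp add: picard_def algebra_simps)
qed

text \<open>The extension \<open>w\<close> is the limit of the iterates. It is only claimed to agree
  with \<open>h\<close> on \<open>V\<close>; that it solves the system in the rest of the ball is
  not asserted.\<close>

lemma pfaffian_extension:
  fixes a :: "'n::finite \<Rightarrow> 'm::finite \<Rightarrow> 'm \<Rightarrow> complex ^ 'n \<Rightarrow> complex"
  assumes S: "open S" "x \<in> S" and a: "\<And>k b b'. sep_hol S (a k b b')"
  obtains r where "0 < r" "ball x r \<subseteq> S"
    "\<And>V h. \<lbrakk>open V; connected V; V \<noteq> {}; V \<subseteq> ball x r; \<And>b. sep_hol V (h b);
        \<And>k b z. z \<in> V \<Longrightarrow> cpd k (h b) z = (\<Sum>b'\<in>UNIV. a k b b' z * h b' z)\<rbrakk>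
      \<Longrightarrow> \<exists>w. \<forall>b. sep_hol (ball x r) (w b) \<and> (\<forall>z\<in>V. w b z = h b z)"
proof -
  obtain R where R: "0 < R" "cball x R \<subseteq> S" using S open_contains_cball by blast
  have "\<exists>C. \<forall>z\<in>cball x R. norm (a k b b' z) \<le> C" for k b b'
  proof -
    have "compact (a k b b' ` cball x R)"
      using sep_hol_continuous_on[OF a] R by (intro compact_continuous_image) (auto intro: continuous_on_subset)
    thus ?thesis using compact_imp_bounded[of "a k b b' ` cball x R"] unfolding bounded_iff by blast
  qed
  then obtain c0 where c0: "\<And>k b b' z. z \<in> cball x R \<Longrightarrow> norm (a k b b' z) \<le> c0 k b b'" by metis
  \<comment> \<open>The added 1 makes \<open>C\<close> positive, so that the radius
    \<open>1 / (4 * q)\<close> below is meaningful.\<close>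
  define C where "C = (\<Sum>k\<in>UNIV. \<Sum>b\<in>UNIV. \<Sum>b'\<in>UNIV. \<bar>c0 k b b'\<bar>) + 1"
  have C: "norm (a k b b' z) \<le> C" if "z \<in> cball x R" for k b b' z
  proof -
    have "norm (a k b b' z) \<le> \<bar>c0 k b b'\<bar>" using c0[OF that, of k b b'] by simp
    also have "\<dots> \<le> (\<Sum>b'\<in>UNIV. \<bar>c0 k b b'\<bar>)" by (rule member_le_sum) auto
    also have "\<dots> \<le> (\<Sum>b\<in>UNIV. \<Sum>b'\<in>UNIV. \<bar>c0 k b b'\<bar>)"
      by (rule member_le_sum[of b UNIV "\<lambda>b. \<Sum>b'\<in>UNIV. \<bar>c0 k b b'\<bar>"]) (auto intro: sum_nonneg)
    also have "\<dots> \<le> (\<Sum>k\<in>UNIV. \<Sum>b\<in>UNIV. \<Sum>b'\<in>UNIV. \<bar>c0 k b b'\<bar>)"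
      by (rule member_le_sum[of k UNIV "\<lambda>k. \<Sum>b\<in>UNIV. \<Sum>b'\<in>UNIV. \<bar>c0 k b b'\<bar>"]) (auto intro: sum_nonneg)
    finally show ?thesis by (simp add: C_def)
  qed
  have C0: "0 < C" unfolding C_def by (intro add_nonneg_pos sum_nonneg) auto
  define q where "q = real CARD('n) * (real CARD('m) * C)"
  have q: "0 < q" unfolding q_def using C0 by simp
  \<comment> \<open>The starting point may lie anywhere in the ball, so distances from it are
    bounded by \<open>2 * r\<close>; the factor 4 then gives the contraction constant 1/2.\<close>
  define r where "r = min R (1 / (4 * q))"
  have r: "0 < r" "ball x r \<subseteq> cball x R" "CARD('n) * (2 * r) * (CARD('m) * C) \<le> 1/2"
  proof -
    show "0 < r" using R q by (simp add: r_def)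
    show "ball x r \<subseteq> cball x R" by (auto simp: r_def)
    have "q * r \<le> q * (1 / (4 * q))" using q by (intro mult_left_mono) (auto simp: r_def)
    also have "\<dots> = 1 / 4" using q by simp
    finally have "2 * (q * r) \<le> 1 / 2" by simp
    moreover have "CARD('n) * (2 * r) * (CARD('m) * C) = 2 * (q * r)" by (simp add: q_def)
    ultimately show "CARD('n) * (2 * r) * (CARD('m) * C) \<le> 1/2" by (simp only:)
  qed
  have "\<exists>w. \<forall>b. sep_hol (ball x r) (w b) \<and> (\<forall>z\<in>V. w b z = h b z)"
    if V: "open V" "connected V" "V \<noteq> {}" "V \<subseteq> ball x r" and h: "\<And>b. sep_hol V (h b)"
      and eq: "\<And>k b z. z \<in> V \<Longrightarrow> cpd k (h b) z = (\<Sum>b'\<in>UNIV. a k b b' z * h b' z)" for V h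
  proof -
    obtain z0 where z0: "z0 \<in> V" using V by blast
    \<comment> \<open>The closed ball is compact, so \<open>h\<close> is bounded on
      \<open>D\<close>; on \<open>V\<close> it may be unbounded.\<close>
    obtain \<delta> where \<delta>: "0 < \<delta>" "cball z0 \<delta> \<subseteq> V" using V z0 open_contains_cball by blast
    define B where "B = ball x r"
    define D where "D = ball z0 \<delta>"
    have DV: "D \<subseteq> V" using \<delta> ball_subset_cball unfolding D_def by blast
    have B: "open B" "convex B" "z0 \<in> B" and D: "open D" "convex D" "z0 \<in> D"
      using z0 V \<delta> by (auto simp: B_def D_def)
    have aB: "sep_hol B (a k b b')" and aD: "sep_hol D (a k b b')" for k b b'
      using r R V DV by (auto intro!: sep_hol_subset[OF a] simp: B_def)
    have CB: "norm (a k b b' z) \<le> C" if "z \<in> B" for k b b' z using C r that by (auto simp: B_def)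
    have rB: "norm (z - z0) \<le> 2 * r" if "z \<in> B" for z
    proof -
      have "dist z z0 \<le> dist x z + dist x z0" by (rule dist_triangle3)
      also have "\<dots> \<le> r + r" using that B(3) by (intro add_mono) (auto simp: B_def)
      finally show ?thesis by (simp add: dist_norm)
    qed
    have DB: "D \<subseteq> B" using DV V by (auto simp: B_def)
    define c where "c = (\<lambda>b. h b z0)"
    define W where "W = (\<lambda>n. (picard a z0 c ^^ n) (\<lambda>b _. c b))"
    have W_Suc: "W (Suc n) = picard a z0 c (W n)" for n by (simp add: W_def)
    have WB: "sep_hol B (W n b)" for n b
    proof (induction n arbitrary: b)
      case 0
      show ?case by (simp add: W_def sep_hol_const)
    next
      case (Suc n)
      show ?case unfolding W_Suc by (rule sep_hol_picard[OF B aB Suc])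
    qed
    note contr = picard_contraction[OF B(2,3) aB _ _ CB rB r(3)]
    \<comment> \<open>\<open>W 0\<close> is the image of the zero family under
      \<open>picard\<close>, so the contraction estimate also controls the first difference, by the
      size of \<open>c\<close>.\<close>
    define K where "K = (\<Sum>b\<in>UNIV. norm (c b))"
    have K: "norm (W (Suc n) b z - W n b z) \<le> K * (1/2) ^ n" if "z \<in> B" for n b z
      using that
    proof (induction n arbitrary: b z)
      case 0
      have "norm (c b) \<le> K" for b unfolding K_def by (rule member_le_sum) auto
      hence "norm (picard a z0 c (W 0) b z - picard a z0 c (\<lambda>_ _. 0) b z) \<le> K / 2"
        by (intro contr) (auto simp: WB sep_hol_const 0 W_def)
      moreover have "picard a z0 c (\<lambda>_ _. 0) b z = W 0 b z" by (simp add: picard_def W_def)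
      moreover have "0 \<le> K" by (simp add: K_def sum_nonneg)
      ultimately show ?case by (simp add: W_Suc)
    next
      case (Suc n)
      have "norm (picard a z0 c (W (Suc n)) b z - picard a z0 c (W n) b z) \<le> K * (1/2) ^ n / 2"
        by (intro contr WB Suc)
      thus ?case by (simp add: W_Suc)
    qed
    define w where "w = (\<lambda>b z. W 0 b z + (\<Sum>n. W (Suc n) b z - W n b z))"
    have "uniform_limit B (\<lambda>n z. \<Sum>i<n. W (Suc i) b z - W i b z) (\<lambda>z. \<Sum>n. W (Suc n) b z - W n b z) sequentially" for b
      by (rule Weierstrass_m_test[where M = "\<lambda>n. K * (1/2) ^ n"])
         (auto intro!: K summable_mult summable_geometric)
    hence "uniform_limit B (\<lambda>n z. W 0 b z + (\<Sum>i<n. W (Suc i) b z - W i b z)) (w b) sequentially" for b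
      unfolding w_def by (intro uniform_limit_add uniform_limit_const)
    moreover have "W 0 b z + (\<Sum>i<n. W (Suc i) b z - W i b z) = W n b z" for n b z
      using sum_lessThan_telescope[of "\<lambda>i. W i b z" n] by simp
    ultimately have ul: "uniform_limit B (\<lambda>n. W n b) (w b) sequentially" for b by simp
    have wB: "sep_hol B (w b)" for b by (rule sep_hol_uniform_limit[OF B(1) WB ul])
    have hD: "sep_hol D (h b)" for b by (rule sep_hol_subset[OF h DV])
    have "\<exists>M. \<forall>z\<in>D. norm (W 0 b z - h b z) \<le> M" for b
    proof -
      have "compact ((\<lambda>z. W 0 b z - h b z) ` cball z0 \<delta>)"
        using sep_hol_continuous_on[OF h] \<delta>(2)
        by (intro compact_continuous_image continuous_intros) (auto simp: W_def intro: continuous_on_subset)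
      from compact_imp_bounded[OF this] show ?thesis
        unfolding bounded_iff D_def using ball_subset_cball by blast
    qed
    then obtain M where M: "\<And>b z. z \<in> D \<Longrightarrow> norm (W 0 b z - h b z) \<le> M b" by metis
    define L where "L = (\<Sum>b\<in>UNIV. \<bar>M b\<bar>)"
    have L: "norm (W n b z - h b z) \<le> L * (1/2) ^ n" if "z \<in> D" for n b z
      using that
    proof (induction n arbitrary: b z)
      case 0
      have "norm (W 0 b z - h b z) \<le> \<bar>M b\<bar>" using M[OF 0, of b] by simp
      also have "\<dots> \<le> L" unfolding L_def by (rule member_le_sum) auto
      finally show ?case by simp
    next
      case (Suc n)
      have "norm (picard a z0 c (W n) b z - picard a z0 c h b z) \<le> L * (1/2) ^ n / 2"
        by (rule picard_contraction[OF D(2,3) aD sep_hol_subset[OF WB DB] hD CB rB r(3) Suc])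
           (use DB in auto)
      moreover have "picard a z0 c h b z = h b z"
        unfolding c_def by (rule picard_fixed[OF D aD hD eq Suc.prems]) (use DV in blast)
      ultimately show ?case by (simp add: W_Suc)
    qed
    have wh: "w b z = h b z" if z: "z \<in> D" for b z
    proof (rule LIMSEQ_unique)
      show "(\<lambda>n. W n b z) \<longlonglongrightarrow> w b z" using tendsto_uniform_limitI[OF ul] z DB by blast
      have "(\<lambda>n. L * (1/2) ^ n) \<longlonglongrightarrow> 0"
        by (intro tendsto_mult_right_zero LIMSEQ_power_zero) simp
      hence "(\<lambda>n. W n b z - h b z) \<longlonglongrightarrow> 0"
        by (rule Lim_null_comparison[rotated]) (use L[OF z] in auto)
      thus "(\<lambda>n. W n b z) \<longlonglongrightarrow> h b z" by (simp add: LIM_zero_iff)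
    qed
    have "w b z = h b z" if "z \<in> V" for b z
      by (rule identity_theorem[OF V(1,2) sep_hol_subset[OF wB] h D(1) _ DV wh that])
         (use V D in \<open>auto simp: B_def\<close>)
    thus ?thesis using wB by (auto simp: B_def)
  qed
  moreover have "ball x r \<subseteq> S" using r R by blast
  ultimately show ?thesis using that r(1) by blast
qed

section \<open>Overdetermined linear systems\<close>

text \<open>A proper subspace has a nonzero annihilating functional: extend a basis of
  \<open>A\<close> by a vector outside \<open>A\<close> and send only that vector to something
  nonzero.\<close>

lemma subspace_annihilator:
  fixes A :: "(complex ^ 'n) set"
  assumes A: "vec.subspace A"
    and ann: "\<And>f :: 'n \<Rightarrow> complex. (\<And>v. v \<in> A \<Longrightarrow> (\<Sum>m\<in>UNIV. v $ m * f m) = 0) \<Longrightarrow> f = (\<lambda>_. 0)"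
  shows "A = UNIV"
proof (rule ccontr)
  assume "A \<noteq> UNIV"
  then obtain e where e: "e \<notin> A" by blast
  obtain B where B: "B \<subseteq> A" "vec.independent B" "A \<subseteq> vec.span B"
    by (rule vec.maximal_independent_subset)
  have AB: "vec.span B = A" using B vec.span_minimal[OF B(1) A] by blast
  have "vec.independent (insert e B)" using B e AB by (simp add: vec.independent_insert)
  \<comment> \<open>The extension theorem yields a map into \<open>complex ^ 'n\<close>; the
    functional is its coordinate at one arbitrary index.\<close>
  define m0 :: 'n where "m0 = undefined"
  from vec.linear_independent_extend[OF \<open>vec.independent (insert e B)\<close>, of "\<lambda>x. if x = e then axis m0 1 else 0"]
  obtain g :: "complex ^ 'n \<Rightarrow> complex ^ 'n" where g: "Vector_Spaces.linear (*s) (*s) g"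
    and gB: "\<And>x. x \<in> insert e B \<Longrightarrow> g x = (if x = e then axis m0 1 else 0)" by blast
  have mg: "g v $ m0 = (\<Sum>m\<in>UNIV. v $ m * matrix g $ m0 $ m)" for v
    using matrix_works[OF g, of v] by (simp add: matrix_vector_mult_def vec_eq_iff mult.commute)
  have "(\<lambda>m. matrix g $ m0 $ m) = (\<lambda>_. 0)"
  proof (rule ann)
    fix v assume "v \<in> A"
    have "g b = 0" if "b \<in> B" for b using gB[of b] that e B(1) by auto
    moreover have "v \<in> vec.span B" using \<open>v \<in> A\<close> AB by simp
    ultimately have "g v = 0" by (rule vec.linear_eq_0_on_span[OF g])
    thus "(\<Sum>m\<in>UNIV. v $ m * matrix g $ m0 $ m) = 0" using mg[of v] by simp
  qed
  hence "matrix g $ m0 $ m = 0" for m by (rule fun_cong)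
  hence "g e $ m0 = 0" unfolding mg by simp
  thus False using gB[of e] by simp
qed

lemma sum_axis_mult: "(\<Sum>m\<in>UNIV. axis a c $ m * f m) = c * f a"
  for f :: "'n::finite \<Rightarrow> complex"
proof -
  have "axis a c $ m * f m = (if m = a then c * f a else 0)" for m by (simp add: axis_def)
  thus ?thesis by simp
qed

text \<open>
  A first-order equation \<open>\<Sum>n\<in>J. z $ n * \<partial> (\<beta> n) u = c * u\<close> is encoded as \<open>(J, \<beta>, c)\<close>, a
  second-order equation \<open>\<partial> a (\<partial> b u) = \<partial> c (\<partial> d u)\<close> as \<open>((a, b), (c, d))\<close>.
\<close>

type_synonym 'n eq1 = "'n set \<times> ('n \<Rightarrow> 'n) \<times> complex"
type_synonym 'n eq2 = "('n \<times> 'n) \<times> ('n \<times> 'n)"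

definition system_solution ::
  "'n::finite eq1 set \<Rightarrow> 'n eq2 set \<Rightarrow> (complex ^ 'n) set \<Rightarrow> (complex ^ 'n \<Rightarrow> complex) \<Rightarrow> bool" where
  "system_solution F G V u \<longleftrightarrow> sep_hol V u \<and> (\<forall>z\<in>V.
     (\<forall>(J, \<beta>, c)\<in>F. (\<Sum>n\<in>J. z $ n * cpd (\<beta> n) u z) = c * u z) \<and>
     (\<forall>((a, b), (c, d))\<in>G. cpd a (cpd b u) z = cpd c (cpd d u) z))"

text \<open>
  What a solution imposes on its second derivatives \<open>H\<close> and third derivatives \<open>T\<close> at \<open>z\<close>: the first-order
  equations are differentiated twice, the second-order ones once. With \<open>H = 0\<close> these are the
  equations of the symbol.
\<close>

definition jet_relations ::
  "'n::finite eq1 set \<Rightarrow> 'n eq2 set \<Rightarrow> complex ^ 'n \<Rightarrow> ('n \<times> 'n \<Rightarrow> complex) \<Rightarrow> ('n \<times> 'n \<times> 'n \<Rightarrow> complex) \<Rightarrow> bool" where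
  "jet_relations F G z H T \<longleftrightarrow>
     (\<forall>i j k. T (i, j, k) = T (j, i, k) \<and> T (i, j, k) = T (i, k, j)) \<and>
     (\<forall>(J, \<beta>, c)\<in>F. \<forall>v w. (\<Sum>n\<in>J. z $ n * T (\<beta> n, v, w)) + (if v \<in> J then H (\<beta> v, w) else 0)
        + (if w \<in> J then H (v, \<beta> w) else 0) = c * H (v, w)) \<and>
     (\<forall>((a, b), (c, d))\<in>G. \<forall>w. T (a, b, w) = T (c, d, w))"

text \<open>The commutator of \<open>cpd w\<close> with a vector field whose coefficients are
  coordinates: the extra term comes from differentiating \<open>z $ w\<close>.\<close>

lemma cpd_vector_field:
  fixes f :: "complex ^ 'n \<Rightarrow> complex"
  assumes V: "open V" and f: "sep_hol V f" and z: "z \<in> V"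
  shows "cpd w (\<lambda>z. \<Sum>n\<in>J. z $ n * cpd (\<beta> n) f z) z
    = (\<Sum>n\<in>J. z $ n * cpd (\<beta> n) (cpd w f) z) + (if w \<in> J then cpd (\<beta> w) f z else 0)"
proof -
  have "cpd w (\<lambda>z. \<Sum>n\<in>J. z $ n * cpd (\<beta> n) f z) z
      = (\<Sum>n\<in>J. (if n = w then cpd (\<beta> w) f z else 0) + z $ n * cpd (\<beta> n) (cpd w f) z)"
    using z by (subst cpd_sum[of _ V], intro sep_hol_mult sep_hol_coord sep_hol_cpd V f, assumption)
      (auto intro!: sum.cong simp: cpd_mult[OF sep_hol_coord sep_hol_cpd[OF V f] z] cpd_coord
        cpd_commute[OF V f z])
  thus ?thesis by (simp add: sum.distrib add.commute)
qed

lemma sep_hol_vector_field: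
  "open V \<Longrightarrow> sep_hol V f \<Longrightarrow> sep_hol V (\<lambda>z. \<Sum>n\<in>J. z $ n * cpd (\<beta> n) f z)"
  by (intro sep_hol_sum sep_hol_mult sep_hol_coord sep_hol_cpd)

lemma cpd_cong:
  assumes "open V" "sep_hol V f" "\<And>z. z \<in> V \<Longrightarrow> g z = f z" "z \<in> V"
  shows "cpd i g z = cpd i f z"
  using sep_hol_cong(2)[OF assms(2,1), of g z i] assms(3,4) by simp

lemma solution_derivative:
  fixes u :: "complex ^ 'n \<Rightarrow> complex"
  assumes V: "open V" and u: "sep_hol V u"
    and eq: "\<And>z. z \<in> V \<Longrightarrow> (\<Sum>n\<in>J. z $ n * cpd (\<beta> n) u z) = c * u z" and z: "z \<in> V"
  shows "(\<Sum>n\<in>J. z $ n * cpd (\<beta> n) (cpd w u) z) + (if w \<in> J then cpd (\<beta> w) u z else 0) = c * cpd w u z"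
proof -
  have "cpd w (\<lambda>z. \<Sum>n\<in>J. z $ n * cpd (\<beta> n) u z) z = cpd w (\<lambda>z. c * u z) z"
    by (rule cpd_cong[OF V sep_hol_mult[OF sep_hol_const u] eq z])
  thus ?thesis
    by (simp add: cpd_vector_field[OF V u z] cpd_mult[OF sep_hol_const u z] cpd_const)
qed

lemma solution_jet:
  fixes u :: "complex ^ 'n \<Rightarrow> complex"
  assumes V: "open V" and u: "system_solution F G V u" and z: "z \<in> V"
  shows "jet_relations F G z (\<lambda>(i, j). cpd i (cpd j u) z) (\<lambda>(i, j, k). cpd i (cpd j (cpd k u)) z)"
proof -
  have su: "sep_hol V u" using u by (simp add: system_solution_def)
  note s1 = sep_hol_cpd[OF V su] and s2 = sep_hol_cpd[OF V sep_hol_cpd[OF V su]]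
  have sym: "cpd i (cpd j (cpd k u)) z = cpd j (cpd i (cpd k u)) z"
    "cpd i (cpd j (cpd k u)) z = cpd i (cpd k (cpd j u)) z" for i j k
    by (rule cpd_commute[OF V s1 z]) (rule cpd_cong[OF V s2 cpd_commute[OF V su] z])
  have E1: "(\<Sum>n\<in>J. z $ n * cpd (\<beta> n) (cpd v (cpd w u)) z) + (if v \<in> J then cpd (\<beta> v) (cpd w u) z else 0)
        + (if w \<in> J then cpd v (cpd (\<beta> w) u) z else 0) = c * cpd v (cpd w u) z"
    if J: "(J, \<beta>, c) \<in> F" for J \<beta> c v w
  proof -
    have eq: "(\<Sum>n\<in>J. z $ n * cpd (\<beta> n) (cpd w u) z) + (if w \<in> J then cpd (\<beta> w) u z else 0) = c * cpd w u z"
      if "z \<in> V" for z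
      by (rule solution_derivative[OF V su _ that]) (use u J in \<open>auto simp: system_solution_def\<close>)
    have c2: "sep_hol V (\<lambda>z. if w \<in> J then cpd (\<beta> w) u z else 0)"
      by (cases "w \<in> J") (simp_all add: s1 sep_hol_const)
    have "cpd v (\<lambda>z. (\<Sum>n\<in>J. z $ n * cpd (\<beta> n) (cpd w u) z) + (if w \<in> J then cpd (\<beta> w) u z else 0)) z
        = cpd v (\<lambda>z. c * cpd w u z) z"
      by (rule cpd_cong[OF V sep_hol_mult[OF sep_hol_const s1] eq z])
    moreover have "cpd v (\<lambda>z. if w \<in> J then cpd (\<beta> w) u z else 0) z = (if w \<in> J then cpd v (cpd (\<beta> w) u) z else 0)"
      by (cases "w \<in> J") (simp_all add: cpd_const)
    ultimately show ?thesis
      by (simp add: cpd_add[OF sep_hol_vector_field[OF V s1] c2 z] cpd_vector_field[OF V s1 z]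
          cpd_mult[OF sep_hol_const s1 z] cpd_const)
  qed
  have E2: "cpd a (cpd b (cpd w u)) z = cpd c (cpd d (cpd w u)) z" if "((a, b), (c, d)) \<in> G" for a b c d w
  proof -
    have "cpd a (cpd b u) z = cpd c (cpd d u) z" if "z \<in> V" for z
      using u \<open>((a, b), (c, d)) \<in> G\<close> that by (fastforce simp: system_solution_def)
    hence "cpd w (cpd a (cpd b u)) z = cpd w (cpd c (cpd d u)) z"
      by (rule cpd_cong[OF V s2 _ z])
    thus ?thesis using sym by metis
  qed
  show ?thesis
    unfolding jet_relations_def case_prod_conv
  proof (intro conjI allI ballI)
    show "cpd i (cpd j (cpd k u)) z = cpd j (cpd i (cpd k u)) z"
      "cpd i (cpd j (cpd k u)) z = cpd i (cpd k (cpd j u)) z" for i j k by (rule sym)+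
    fix f assume "f \<in> F"
    with E1 show "case f of (J, \<beta>, c) \<Rightarrow> \<forall>v w. (\<Sum>n\<in>J. z $ n * cpd (\<beta> n) (cpd v (cpd w u)) z)
        + (if v \<in> J then cpd (\<beta> v) (cpd w u) z else 0)
        + (if w \<in> J then cpd v (cpd (\<beta> w) u) z else 0) = c * cpd v (cpd w u) z"
      by (cases f) simp
  next
    fix g assume "g \<in> G"
    with E2 show "case g of (ab, cd) \<Rightarrow> (case ab of (a, b) \<Rightarrow> \<lambda>(c, d). \<forall>w.
        cpd a (cpd b (cpd w u)) z = cpd c (cpd d (cpd w u)) z) cd"
      by (cases g) auto
  qed
qed

text \<open>By duality, triviality of the kernel at \<open>x\<close> means that the relations,
  evaluated at \<open>x\<close>, span all covectors. Choosing relations that form the identity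
  matrix at \<open>x\<close> gives a matrix still invertible nearby, and Cramer's rule provides
  holomorphic coefficients.\<close>

lemma jet_solve:
  fixes x :: "complex ^ 'n" and F :: "'n eq1 set" and G :: "'n eq2 set"
  assumes symbol: "\<And>T. jet_relations F G x (\<lambda>_. 0) T \<Longrightarrow> T = (\<lambda>_. 0)"
  obtains S :: "(complex ^ 'n) set" and a where "open S" "x \<in> S" "\<And>m b. sep_hol S (a m b)"
    "\<And>z H T m. z \<in> S \<Longrightarrow> jet_relations F G z H T \<Longrightarrow> T m = (\<Sum>b\<in>UNIV. a m b z * H b)"
proof -
  \<comment> \<open>The linear consequences valid at every point. The coefficients \<open>K\<close>
    of the third derivatives depend on \<open>z\<close>; those of the second derivatives are
    constants, being derivatives of linear coefficients or the constants \<open>c\<close>.\<close>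
  define R :: "((complex ^ 'n \<Rightarrow> complex ^ ('n \<times> 'n \<times> 'n)) \<times> ('n \<times> 'n \<Rightarrow> complex)) set"
    where "R = {(K, L). (\<forall>m. sep_hol UNIV (\<lambda>z. K z $ m)) \<and>
      (\<forall>z H T. jet_relations F G z H T \<longrightarrow> (\<Sum>m\<in>UNIV. K z $ m * T m) = (\<Sum>b\<in>UNIV. L b * H b))}"
  define A where "A = {K x |K L. (K, L) \<in> R}"
  have AI: "K x \<in> A" if "(K, L) \<in> R" for K L using that by (auto simp: A_def)
  have R_binom: "(\<lambda>_. axis m 1 - axis m' 1, \<lambda>_. 0) \<in> R"
    if "\<And>z H T. jet_relations F G z H T \<Longrightarrow> T m = T m'" for m m'
    using that by (auto simp: R_def sep_hol_const left_diff_distrib sum_subtractf sum_axis_mult)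
  have R_field: "(\<lambda>z. \<Sum>n\<in>J. axis (\<beta> n, v, w) (z $ n),
      \<lambda>b. axis (v, w) c $ b - (if v \<in> J then axis (\<beta> v, w) 1 $ b else 0)
          - (if w \<in> J then axis (v, \<beta> w) 1 $ b else 0)) \<in> R"
    if J: "(J, \<beta>, c) \<in> F" for J \<beta> c v w
    unfolding R_def
  proof (intro CollectI case_prodI conjI allI impI)
    fix m
    have "sep_hol UNIV (\<lambda>z. axis (\<beta> n, v, w) (z $ n) $ m)" for n
      by (cases "m = (\<beta> n, v, w)") (simp_all add: axis_def sep_hol_coord sep_hol_const)
    thus "sep_hol UNIV (\<lambda>z. (\<Sum>n\<in>J. axis (\<beta> n, v, w) (z $ n)) $ m)"
      unfolding sum_component by (intro sep_hol_sum)
    fix z H T assume jet: "jet_relations F G z H T"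
    have "(\<Sum>m\<in>UNIV. (\<Sum>n\<in>J. axis (\<beta> n, v, w) (z $ n)) $ m * T m) = (\<Sum>n\<in>J. z $ n * T (\<beta> n, v, w))"
      unfolding sum_component sum_distrib_right by (subst sum.swap) (simp add: sum_axis_mult)
    also have "\<dots> = c * H (v, w) - (if v \<in> J then H (\<beta> v, w) else 0) - (if w \<in> J then H (v, \<beta> w) else 0)"
      using jet J unfolding jet_relations_def by (fastforce simp: algebra_simps)
    also have "\<dots> = (\<Sum>b\<in>UNIV. (axis (v, w) c $ b - (if v \<in> J then axis (\<beta> v, w) 1 $ b else 0)
          - (if w \<in> J then axis (v, \<beta> w) 1 $ b else 0)) * H b)"
      by (simp add: left_diff_distrib sum_subtractf sum_axis_mult)
    finally show "(\<Sum>m\<in>UNIV. (\<Sum>n\<in>J. axis (\<beta> n, v, w) (z $ n)) $ m * T m) = \<dots>" .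
  qed
  \<comment> \<open>A tensor annihilated by every relation evaluated at \<open>x\<close> satisfies the symbol equations.\<close>
  have "vec.subspace A"
  proof (rule vec.subspaceI)
    have "(\<lambda>_. 0, \<lambda>_. 0) \<in> R" by (simp add: R_def sep_hol_const)
    from AI[OF this] show "0 \<in> A" .
    fix v w assume "v \<in> A" "w \<in> A"
    then obtain K L K' L' where vw: "v = K x" "w = K' x" "(K, L) \<in> R" "(K', L') \<in> R" by (auto simp: A_def)
    hence "(\<lambda>z. K z + K' z, \<lambda>b. L b + L' b) \<in> R"
      by (auto simp: R_def sep_hol_add distrib_right sum.distrib)
    from AI[OF this] show "v + w \<in> A" by (simp add: vw)
  next
    fix c v assume "v \<in> A"
    then obtain K L where v: "v = K x" "(K, L) \<in> R" by (auto simp: A_def)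
    hence "(\<lambda>z. c *s K z, \<lambda>b. c * L b) \<in> R"
      by (auto simp: R_def sep_hol_mult sep_hol_const mult.assoc simp flip: sum_distrib_left)
    from AI[OF this] show "c *s v \<in> A" by (simp add: v)
  qed
  hence "A = UNIV"
  proof (rule subspace_annihilator)
    fix T assume ann: "\<And>v. v \<in> A \<Longrightarrow> (\<Sum>m\<in>UNIV. v $ m * T m) = 0"
    have ann': "(\<Sum>m\<in>UNIV. K x $ m * T m) = 0" if "(K, L) \<in> R" for K L
      by (rule ann[OF AI[OF that]])
    have binom: "T m = T m'" if "\<And>z H T. jet_relations F G z H T \<Longrightarrow> T m = T m'" for m m'
      using ann'[OF R_binom[OF that]] by (simp add: left_diff_distrib sum_subtractf sum_axis_mult)
    show "T = (\<lambda>_. 0)"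
    proof (rule symbol, unfold jet_relations_def, intro conjI allI)
      fix i j k
      show "T (i, j, k) = T (j, i, k)" "T (i, j, k) = T (i, k, j)"
        by (rule binom; simp add: jet_relations_def)+
    next
      have "(\<Sum>n\<in>J. x $ n * T (\<beta> n, v, w)) = 0" if "(J, \<beta>, c) \<in> F" for J \<beta> c v w
        using ann'[OF R_field[OF that]] unfolding sum_component sum_distrib_right
        by (subst (asm) sum.swap) (simp add: sum_axis_mult)
      thus "\<forall>(J, \<beta>, c)\<in>F. \<forall>v w. (\<Sum>n\<in>J. x $ n * T (\<beta> n, v, w)) + (if v \<in> J then 0 else 0)
        + (if w \<in> J then 0 else 0) = c * 0" by auto
    next
      have "T (a, b, w) = T (c, d, w)" if "((a, b), (c, d)) \<in> G" for a b c d w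
        by (rule binom) (use that in \<open>fastforce simp: jet_relations_def\<close>)
      thus "\<forall>((a, b), (c, d))\<in>G. \<forall>w. T (a, b, w) = T (c, d, w)" by auto
    qed
  qed
  have "\<exists>KL. KL \<in> R \<and> fst KL x = axis m 1" for m
  proof -
    have "axis m 1 \<in> A" using \<open>A = UNIV\<close> by simp
    then obtain K L where "axis m 1 = K x" "(K, L) \<in> R" unfolding A_def by blast
    thus ?thesis by (intro exI[of _ "(K, L)"]) simp
  qed
  then obtain KL where KL: "\<And>m. KL m \<in> R" "\<And>m. fst (KL m) x = axis m 1" by metis
  \<comment> \<open>The rows are global relations, the one with index \<open>m\<close> reducing at
    \<open>x\<close> to the single unknown \<open>T m\<close>.\<close>
  define M where "M = (\<lambda>z. \<chi> m. fst (KL m) z)"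
  define L where "L = (\<lambda>m. snd (KL m))"
  have KLR: "(fst (KL m), L m) \<in> R" for m using KL(1)[of m] by (simp add: L_def)
  have sM: "sep_hol UNIV (\<lambda>z. M z $ m $ m')" for m m'
    using KLR[of m] unfolding R_def mem_Collect_eq case_prod_conv M_def vec_lambda_beta by blast
  have MT: "(\<Sum>m'\<in>UNIV. M z $ m $ m' * T m') = (\<Sum>b\<in>UNIV. L m b * H b)"
    if "jet_relations F G z H T" for z H T m
    using KLR[of m] that unfolding R_def mem_Collect_eq case_prod_conv M_def vec_lambda_beta by blast
  have "M x = mat 1" by (simp add: M_def KL vec_eq_iff mat_def axis_def eq_commute)
  hence dx: "det (M x) = 1" by simp
  have sdet: "sep_hol UNIV (\<lambda>z. det (M z))" by (rule sep_hol_det[OF sM])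
  define S where "S = {z. det (M z) \<noteq> 0}"
  have "S = (\<lambda>z. det (M z)) -` (- {0})" by (auto simp: S_def)
  hence oS: "open S" using open_vimage[OF _ sep_hol_continuous_on[OF sdet], of "- {0}"]
    by (simp add: open_Compl)
  \<comment> \<open>Cramer's rule with one right-hand side for each second derivative
    \<open>b\<close>, namely the column of the constants \<open>L i b\<close>.\<close>
  define a where "a = (\<lambda>m b z. det (\<chi> i j. if j = m then L i b else M z $ i $ j) / det (M z))"
  have sa: "sep_hol S (a m b)" for m b
    unfolding a_def
  proof (intro sep_hol_divide sep_hol_det)
    show "sep_hol S (\<lambda>z. (\<chi> i j. if j = m then L i b else M z $ i $ j) $ i $ j)" for i j
      by (cases "j = m") (auto simp: sep_hol_const intro: sep_hol_subset[OF sM])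
  qed (auto simp: S_def intro: sep_hol_subset[OF sM])
  have sol: "T m = (\<Sum>b\<in>UNIV. a m b z * H b)" if z: "z \<in> S" and jet: "jet_relations F G z H T" for z H T m
  proof -
    have d: "det (M z) \<noteq> 0" using z by (simp add: S_def)
    have La: "(\<Sum>m\<in>UNIV. M z $ i $ m * a m b z) = L i b" for i b
    proof -
      have "M z *v (\<chi> m. a m b z) = (\<chi> i. L i b)"
        unfolding cramer[OF d] by (simp add: a_def cong: if_cong)
      from arg_cong[OF this, of "\<lambda>v. v $ i"] show ?thesis by (simp add: matrix_vector_mult_def)
    qed
    have 1: "M z *v (\<chi> m. \<Sum>b\<in>UNIV. a m b z * H b) = (\<chi> i. \<Sum>b\<in>UNIV. L i b * H b)"
      unfolding La[symmetric] matrix_vector_mult_def vec_eq_iff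
      by (simp add: sum_distrib_left sum_distrib_right mult.assoc) (intro allI sum.swap)
    have 2: "M z *v (\<chi> m. T m) = (\<chi> i. \<Sum>b\<in>UNIV. L i b * H b)"
      using MT[OF jet] by (simp add: matrix_vector_mult_def vec_eq_iff)
    have "(\<chi> m. T m) = (\<chi> m. \<Sum>b\<in>UNIV. a m b z * H b)"
      by (rule trans[OF iffD1[OF cramer[OF d] 2] iffD1[OF cramer[OF d] 1, symmetric]])
    from arg_cong[OF this, of "\<lambda>v. v $ m"] show ?thesis by simp
  qed
  have "x \<in> S" by (simp add: S_def dx)
  show ?thesis by (rule that[of S a]) (fact oS \<open>x \<in> S\<close> sa sol)+
qed

text \<open>By the Euler equation \<open>u\<close> has degree \<open>c\<close> and its first
  derivatives have degree \<open>c - 1\<close>, so \<open>u\<close> is recovered from its second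
  derivatives after division by \<open>c * (c - 1)\<close>; hence the two excluded values.\<close>

theorem system_extension:
  fixes x :: "complex ^ 'n" and F :: "'n eq1 set" and G :: "'n eq2 set"
  assumes symbol: "\<And>T. jet_relations F G x (\<lambda>_. 0) T \<Longrightarrow> T = (\<lambda>_. 0)"
    and euler: "(UNIV, id, c) \<in> F" "c \<noteq> 0" "c \<noteq> 1"
  obtains r where "0 < r"
    "\<And>V u. \<lbrakk>open V; connected V; V \<noteq> {}; V \<subseteq> ball x r; system_solution F G V u\<rbrakk>
      \<Longrightarrow> \<exists>w. sep_hol (ball x r) w \<and> (\<forall>z\<in>V. w z = u z)"
proof -
  obtain S a where S: "open S" "x \<in> S" and a: "\<And>m b. sep_hol S (a m b)"
    and T: "\<And>z H T m. z \<in> S \<Longrightarrow> jet_relations F G z H T \<Longrightarrow> T m = (\<Sum>b\<in>UNIV. a m b z * H b)"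
    using jet_solve[OF symbol] by blast
  obtain r where r: "0 < r" "ball x r \<subseteq> S" and ext: "\<And>V h. \<lbrakk>open V; connected V; V \<noteq> {}; V \<subseteq> ball x r; \<And>b. sep_hol V (h b);
        \<And>k b z. z \<in> V \<Longrightarrow> cpd k (h b) z = (\<Sum>b'\<in>UNIV. a (k, b) b' z * h b' z)\<rbrakk>
      \<Longrightarrow> \<exists>w. \<forall>b. sep_hol (ball x r) (w b) \<and> (\<forall>z\<in>V. w b z = h b z)"
    using pfaffian_extension[OF S, of "\<lambda>k b b'. a (k, b) b'"] a by blast
  have "\<exists>w. sep_hol (ball x r) w \<and> (\<forall>z\<in>V. w z = u z)"
    if V: "open V" "connected V" "V \<noteq> {}" "V \<subseteq> ball x r" and u: "system_solution F G V u" for V u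
  proof -
    have su: "sep_hol V u" using u by (simp add: system_solution_def)
    define h where "h = (\<lambda>(i, j). cpd i (cpd j u))"
    have "\<exists>w. \<forall>b. sep_hol (ball x r) (w b) \<and> (\<forall>z\<in>V. w b z = h b z)"
    proof (rule ext[OF V])
      show "sep_hol V (h b)" for b by (auto simp: h_def split: prod.split intro: sep_hol_cpd V su)
      fix k b z assume z: "z \<in> V"
      hence "z \<in> S" using V r by blast
      from T[OF this solution_jet[OF V(1) u z], of "(k, b)"]
      show "cpd k (h b) z = (\<Sum>b'\<in>UNIV. a (k, b) b' z * h b' z)"
        by (cases b) (simp add: h_def split_beta)
    qed
    then obtain w where w: "\<And>b. sep_hol (ball x r) (w b)" "\<And>b z. z \<in> V \<Longrightarrow> w b z = h b z" by blast
    define W where "W = (\<lambda>z. (\<Sum>i\<in>UNIV. z $ i * (\<Sum>j\<in>UNIV. z $ j * w (i, j) z)) / (c * (c - 1)))"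
    have "sep_hol (ball x r) W"
      unfolding W_def by (intro sep_hol_divide sep_hol_sum sep_hol_mult sep_hol_coord w sep_hol_const)
        (use euler in auto)
    moreover have "W z = u z" if z: "z \<in> V" for z
    proof -
      have e: "(\<Sum>n\<in>UNIV. z $ n * cpd n u z) = c * u z" if "z \<in> V" for z
        using u euler(1) that by (force simp: system_solution_def)
      have "(\<Sum>n\<in>UNIV. z $ n * cpd n (cpd i u) z) + cpd i u z = c * cpd i u z" for i
        using solution_derivative[OF V(1) su _ z, where J = UNIV and \<beta> = id and c = c and w = i] e by simp
      hence "(\<Sum>j\<in>UNIV. z $ j * cpd j (cpd i u) z) = (c - 1) * cpd i u z" for i
        by (simp add: algebra_simps eq_diff_eq)
      hence "(\<Sum>j\<in>UNIV. z $ j * w (i, j) z) = (c - 1) * cpd i u z" for i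
        by (simp add: w(2)[OF z] h_def cpd_commute[OF V(1) su z, of i])
      hence "W z = (\<Sum>i\<in>UNIV. (c - 1) * (z $ i * cpd i u z)) / (c * (c - 1))"
        by (simp add: W_def mult_ac)
      also have "\<dots> = u z" using euler e[OF z] by (simp flip: sum_distrib_left)
      finally show ?thesis .
    qed
    ultimately show ?thesis by blast
  qed
  thus ?thesis using that r(1) by blast
qed

section \<open>The symbol of the system at a point in general position\<close>

lemma D3_expand:
  "D3 x p q r =
    (let m = (\<lambda>f g h. f p * (g q * h r - g r * h q) - f q * (g p * h r - g r * h p) + f r * (g p * h q - g q * h p));
         a = (\<lambda>s. x$s$1$1); b = (\<lambda>s. x$s$1$2); c = (\<lambda>s. x$s$2$1); d = (\<lambda>s. x$s$2$2)
     in m b c d * m a b c - m a c d * m a b d)"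
  unfolding D3_def minor3_def coeff_mat_def coeff_row_def Let_def det_3
  apply (simp add: column_def vector_def)
  apply (simp add: algebra_simps)
  done

text \<open>
  For \<open>P = (a, b; c, d)\<close>, \<open>Q = (e, f; g, h)\<close> and \<open>S = (s, t; k, l)\<close> the hypotheses say that \<open>S\<close> is
  orthogonal to \<open>P\<close> and \<open>Q\<close>, that the pencil of \<open>P\<close> and \<open>Q\<close> has distinct roots, and that
  \<open>P\<^sup>T S Q\<^sup>T = Q\<^sup>T S P\<^sup>T\<close>. If \<open>P\<close> is invertible, this makes \<open>P S\<^sup>T\<close> commute with \<open>Q P\<^sup>-\<^sup>1\<close>, hence a polynomial in it.
\<close>

lemma tangency_vanishes:
  fixes a b c d e f g h s t k l :: complex
  assumes "a * s + b * t + c * k + d * l = 0" "e * s + f * t + g * k + h * l = 0"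
   and ne: "(a * h + d * e - b * g - c * f)^2 - (a * d + d * a - b * c - c * b) * (e * h+h * e-f * g-g * f) \<noteq> 0"
   and e: "(a * s+c * k)*e + (a * t+c * l)*f = (e * s+g * k)*a + (e * t+g * l)*b"
     "(a * s+c * k)*g + (a * t+c * l)*h = (e * s+g * k)*c + (e * t+g * l)*d"
     "(b * s+d * k)*e + (b * t+d * l)*f = (f * s+h * k)*a + (f * t+h * l)*b"
     "(b * s+d * k)*g + (b * t+d * l)*h = (f * s+h * k)*c + (f * t+h * l)*d"
  shows "s = 0 \<and> t = 0 \<and> k = 0 \<and> l = 0"
proof -
  \<comment> \<open>Writing the commuting matrix as alpha + beta M with M = Q P^-1, orthogonality
    says that it and its product with M have trace zero. This is a linear system for alpha and beta
    whose determinant is the discriminant of M, the quantity in \<open>ne\<close> divided by the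
    square of det P. The identities clear the denominators and so cover singular P as well.\<close>
  have "((a * h + d * e - b * g - c * f)^2 - (a * d + d * a - b * c - c * b) * (e * h+h * e-f * g-g * f)) * s = 0"
    using assms(1,2) e by algebra
  moreover have "((a * h + d * e - b * g - c * f)^2 - (a * d + d * a - b * c - c * b) * (e * h+h * e-f * g-g * f)) * t = 0"
    using assms(1,2) e by algebra
  moreover have "((a * h + d * e - b * g - c * f)^2 - (a * d + d * a - b * c - c * b) * (e * h+h * e-f * g-g * f)) * k = 0"
    using assms(1,2) e by algebra
  moreover have "((a * h + d * e - b * g - c * f)^2 - (a * d + d * a - b * c - c * b) * (e * h+h * e-f * g-g * f)) * l = 0"
    using assms(1,2) e by algebra
  ultimately show ?thesis using ne by simp
qed

text \<open>The signed 3 by 3 minors form the null vector of the three bilinear forms, read as a 2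
  by 2 matrix whose determinant is, up to sign, the expression in \<open>ne\<close>. A singular null
  matrix would have the form xi_i eta_j, that is, be a common point of the three curves.\<close>

lemma common_zero_vanishes:
  fixes P Q R :: "2 \<Rightarrow> 2 \<Rightarrow> complex" and A :: "2 \<Rightarrow> 2 \<Rightarrow> 2 \<Rightarrow> complex"
  defines "n \<equiv> (\<lambda>f g h. f P * (g Q * h R - g R * h Q) - f Q * (g P * h R - g R * h P)
              + f R * (g P * h Q - g Q * h P) :: complex)"
    and "a \<equiv> (\<lambda>S. S 1 1)" and "b \<equiv> (\<lambda>S. S 1 2)" and "c \<equiv> (\<lambda>S. S 2 1)" and "d \<equiv> (\<lambda>S. S 2 2)"
  assumes ne: "n b c d * n a b c - n a c d * n a b d \<noteq> 0"
    and P: "\<And>m. (\<Sum>k\<in>UNIV. \<Sum>l\<in>UNIV. P k l * A m k l) = 0"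
    and Q: "\<And>m. (\<Sum>k\<in>UNIV. \<Sum>l\<in>UNIV. Q k l * A m k l) = 0"
    and R: "\<And>m. (\<Sum>k\<in>UNIV. \<Sum>l\<in>UNIV. R k l * A m k l) = 0"
    and A: "\<And>m k l. A m k l = A k m l"
  shows "A m k l = 0"
proof -
  define n1 n2 n3 n4 where "n1 = n b c d" and "n2 = - n a c d" and "n3 = n a b d" and "n4 = - n a b c"
  note n = n1_def n2_def n3_def n4_def n_def a_def b_def c_def d_def
  note h = P Q R
  have *: "n1 * A m 1 2 = n2 * A m 1 1" "n1 * A m 2 1 = n3 * A m 1 1" "n1 * A m 2 2 = n4 * A m 1 1"
    "n2 * A m 2 1 = n3 * A m 1 2" "n2 * A m 2 2 = n4 * A m 1 2" "n3 * A m 2 2 = n4 * A m 2 1" for m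
    using h[of m] unfolding n sum_2 by algebra+
  \<comment> \<open>So \<open>A 1\<close> and \<open>A 2\<close> are multiples of the null vector \<open>n\<close>; their overlap forces \<open>n\<close> to have rank one.\<close>
  have D: "n1 * n4 - n2 * n3 \<noteq> 0" using ne by (simp add: n1_def n2_def n3_def n4_def algebra_simps)
  have "(n1 * n4 - n2 * n3) * A 1 2 1 = 0" "(n1 * n4 - n2 * n3) * A 1 2 2 = 0"
    using *[of 1] *[of 2] A[of 1 2 1] A[of 1 2 2] by algebra+
  with D have c: "A 1 2 1 = 0" "A 1 2 2 = 0" "A 2 1 1 = 0" "A 2 1 2 = 0"
    using A[of 1 2 1] A[of 1 2 2] by simp_all
  have "(n1 * n4 - n2 * n3) * A 1 1 1 = 0" "(n1 * n4 - n2 * n3) * A 1 1 2 = 0"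
    "(n1 * n4 - n2 * n3) * A 2 2 1 = 0" "(n1 * n4 - n2 * n3) * A 2 2 2 = 0"
    using *[of 1] *[of 2] c by algebra+
  with D c have "A m k l = 0" if "m \<in> {1,2}" "k \<in> {1,2}" "l \<in> {1,2}" for m k l
    using that by auto
  thus ?thesis using exhaust_2 by blast
qed

lemma common_zero_vanishes_D3:
  fixes A :: "2 \<Rightarrow> 2 \<Rightarrow> 2 \<Rightarrow> complex"
  assumes "D3 x p q r \<noteq> 0"
    and "\<And>m. (\<Sum>k\<in>UNIV. \<Sum>l\<in>UNIV. x$p$k$l * A m k l) = 0"
    and "\<And>m. (\<Sum>k\<in>UNIV. \<Sum>l\<in>UNIV. x$q$k$l * A m k l) = 0"
    and "\<And>m. (\<Sum>k\<in>UNIV. \<Sum>l\<in>UNIV. x$r$k$l * A m k l) = 0"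
    and "\<And>m k l. A m k l = A k m l"
  shows "A m k l = 0"
  by (rule common_zero_vanishes[of "\<lambda>k l. x$p$k$l" "\<lambda>k l. x$q$k$l" "\<lambda>k l. x$r$k$l" A])
     (use assms in \<open>simp_all add: D3_expand Let_def\<close>)

section \<open>Vanishing of the cubic symbol tensor\<close>

type_synonym idx = "4 \<times> 2 \<times> 2"

text \<open>\<open>T\<close> is a linear form on cubic polynomials in the 16 covector variables that
  kills all cubic multiples of the principal symbols. That it vanishes means that the symbols
  generate all cubics.\<close>

locale symbol_kernel =
  fixes x :: pt and T :: "idx \<Rightarrow> idx \<Rightarrow> idx \<Rightarrow> complex"
  assumes xX: "x \<in> X_circ"
    and sym12: "T a b c = T b a c"
    and sym23: "T a b c = T a c b"
    and swap: "T (q,i,j) (p,k,l) w = T (q,k,l) (p,i,j) w"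
    and segre: "T (q,1,1) (p,2,2) w = T (q,2,1) (p,1,2) w"
    and curve: "(\<Sum>j\<in>UNIV. \<Sum>k\<in>UNIV. x$p$j$k * T (p,j,k) v w) = 0"
    and left: "(\<Sum>p\<in>UNIV. \<Sum>j\<in>UNIV. x$p$l$j * T (p,m,j) v w) = 0"
    and right: "(\<Sum>p\<in>UNIV. \<Sum>j\<in>UNIV. x$p$j$l * T (p,j,m) v w) = 0"
begin

text \<open>With \<open>swap\<close>, this lets the row and column indices move between slots
  independently of each other and of the curve index, as for the monomials in a_p s_i t_j on the
  Segre cone.\<close>

lemma swap1: "T (q,i,j) (p,k,l) w = T (q,k,j) (p,i,l) w"
proof -
  consider "i = k" | "j = l" | "i \<noteq> k" "j \<noteq> l" by blast
  thus ?thesis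
  proof cases
    case 3
    thus ?thesis using exhaust_2[of i] exhaust_2[of j] exhaust_2[of k] exhaust_2[of l]
      segre[of q p w] swap[of q 1 1 p 2 2 w] swap[of q 2 1 p 1 2 w] by auto
  qed (use swap in auto)
qed

lemma swap23: "T w (q,i,j) (p,k,l) = T w (q,k,l) (p,i,j)"
  using swap[of q i j p k l w] by (metis sym12 sym23)

text \<open>With \<open>j\<close> and the pair \<open>m\<close> frozen, the pair
  \<open>(k,l)\<close> may be attached to any of the three curves, so all three equations
  \<open>curve\<close> apply to the same slice; this is the situation of (g3).\<close>

lemma vanish_distinct:
  assumes "p \<noteq> q" "q \<noteq> r" "r \<noteq> p"
  shows "T (p,i,j) (q,k,l) (r,m) = 0"
proof -
  let ?A = "\<lambda>i k l. T (p,i,j) (q,k,l) (r,m)"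
  obtain m1 m2 where m: "m = (m1, m2)" by force
  have e: "T (p,i,j) (q,k,l) (r,m) = T (p,k,l) (q,i,j) (r,m)"
    "T (p,i,j) (q,k,l) (r,m) = T (r,k,l) (p,i,j) (q,m)"
    "T (p,i,j) (q,k,l) (r,m) = T (q,k,l) (p,i,j) (r,m)"  for i j k l
    using swap[of p i j q k l "(r,m)"] swap23[of "(p,i,j)" q k l r m1 m2, folded m]
      sym12 sym23 by metis+
  show ?thesis
  proof (rule common_zero_vanishes_D3[of x p q r ?A])
    show "D3 x p q r \<noteq> 0" using xX assms by (simp add: X_circ_def)
  next
    fix i show "(\<Sum>k\<in>UNIV. \<Sum>l\<in>UNIV. x $ p $ k $ l * T (p, i, j) (q, k, l) (r, m)) = 0"
      unfolding e(1)[of i] by (rule curve)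
  next
    fix i show "(\<Sum>k\<in>UNIV. \<Sum>l\<in>UNIV. x $ q $ k $ l * T (p, i, j) (q, k, l) (r, m)) = 0"
      unfolding e(3)[of i] by (rule curve)
  next
    fix i show "(\<Sum>k\<in>UNIV. \<Sum>l\<in>UNIV. x $ r $ k $ l * T (p, i, j) (q, k, l) (r, m)) = 0"
      unfolding e(2)[of i] by (rule curve)
  qed (rule swap1)
qed

lemma sum_only:
  fixes f :: "4 \<Rightarrow> complex"
  assumes "\<And>r. r \<noteq> p \<Longrightarrow> r \<noteq> q \<Longrightarrow> f r = 0"
  shows "p \<noteq> q \<Longrightarrow> (\<Sum>r\<in>UNIV. f r) = f p + f q" "p = q \<Longrightarrow> (\<Sum>r\<in>UNIV. f r) = f p"
  using sum.mono_neutral_right[of UNIV "{p,q}" f] assms by auto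

text \<open>By \<open>vanish_distinct\<close> only two curves survive in \<open>left\<close> and
  \<open>right\<close>. With P and Q the coefficient matrices of \<open>p\<close> and
  \<open>q\<close>, these read U P^T = - S Q^T and P^T U = - Q^T S, while \<open>curve\<close> makes
  S orthogonal to both P and Q.\<close>

lemma vanish_pair:
  assumes "p \<noteq> q"
  shows "T (p,m,j) (q,k,l) (q,w) = 0"
proof -
  obtain w1 w2 where w: "w = (w1, w2)" by force
  define S where "S = (\<lambda>m j. T (p,m,j) (q,k,l) (q,w))"
  define U where "U = (\<lambda>m j. T (p,m,j) (p,k,l) (q,w))"
  have S: "T (q,m,j) (p,k,l) (q,w) = S m j" for m j
    using swap sym12 by (metis S_def)
  have "(\<Sum>m\<in>UNIV. \<Sum>j\<in>UNIV. x$p$m$j * S m j) = 0"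
    unfolding S_def by (rule curve)
  moreover have "(\<Sum>m\<in>UNIV. \<Sum>j\<in>UNIV. x$q$m$j * S m j) = 0"
    unfolding S[symmetric] by (rule curve)
  moreover have "(\<Sum>j\<in>UNIV. x$p$h$j * U m j) + (\<Sum>j\<in>UNIV. x$q$h$j * S m j) = 0" for h m
    unfolding S[symmetric] U_def left[of h m "(p,k,l)" "(q,w)", symmetric]
    by (rule sum_only(1)[symmetric, OF _ assms])
       (auto simp: w vanish_distinct assms intro!: sum.neutral)
  moreover have "(\<Sum>j\<in>UNIV. x$p$j$h * U j m) + (\<Sum>j\<in>UNIV. x$q$j$h * S j m) = 0" for h m
    unfolding S[symmetric] U_def right[of h m "(p,k,l)" "(q,w)", symmetric]
    by (rule sum_only(1)[symmetric, OF _ assms])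
       (auto simp: w vanish_distinct assms intro!: sum.neutral)
  ultimately have e:
     "x$p$1$1 * S 1 1 + x$p$1$2 * S 1 2 + x$p$2$1 * S 2 1 + x$p$2$2 * S 2 2 = 0"
     "x$q$1$1 * S 1 1 + x$q$1$2 * S 1 2 + x$q$2$1 * S 2 1 + x$q$2$2 * S 2 2 = 0"
     "\<And>h m. x$p$h$1 * U m 1 + x$p$h$2 * U m 2 = - (x$q$h$1 * S m 1 + x$q$h$2 * S m 2)"
     "\<And>h m. x$p$1$h * U 1 m + x$p$2$h * U 2 m = - (x$q$1$h * S 1 m + x$q$2$h * S 2 m)"
    by (simp_all add: sum_2 add.assoc eq_neg_iff_add_eq_0 del: minus_add_distrib add_uminus_conv_diff)
  \<comment> \<open>Elimination of \<open>U\<close>: both sides are the entries of - P^T U P^T. This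
    is the last hypothesis of \<open>tangency_vanishes\<close>.\<close>
  have c: "(x$p$1$i * S 1 1 + x$p$2$i * S 2 1) * x$q$h$1 + (x$p$1$i * S 1 2 + x$p$2$i * S 2 2) * x$q$h$2
    = (x$q$1$i * S 1 1 + x$q$2$i * S 2 1) * x$p$h$1 + (x$q$1$i * S 1 2 + x$q$2$i * S 2 2) * x$p$h$2" for i h
    using e(3)[of h 1] e(3)[of h 2] e(4)[of i 1] e(4)[of i 2] by algebra
  have "(D2 x p q)\<^sup>2 - D2 x p p * D2 x q q \<noteq> 0"
    using xX assms by (simp add: X_circ_def)
  hence "S 1 1 = 0 \<and> S 1 2 = 0 \<and> S 2 1 = 0 \<and> S 2 2 = 0"
    unfolding D2_def
    by (intro tangency_vanishes[of "x$p$1$1" _ "x$p$1$2" _ "x$p$2$1" _ "x$p$2$2" _ "x$q$1$1" "x$q$1$2" "x$q$2$1" "x$q$2$2"] e c)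
  hence "S m j = 0" using exhaust_2[of m] exhaust_2[of j] by auto
  thus ?thesis by (simp add: S_def)
qed

text \<open>Once the mixed entries are gone, \<open>left\<close> is a homogeneous system with the
  matrix of the curve \<open>p\<close>, and \<open>D2 x p p\<close> is twice its
  determinant.\<close>

lemma vanish_single: "T (p,m,j) (p,v) (p,w) = 0"
proof -
  obtain v1 v2 w1 w2 where v: "v = (v1, v2)" "w = (w1,w2)" by (metis surj_pair)
  have "(\<Sum>j\<in>UNIV. x$p$h$j * T (p,m,j) (p,v) (p,w)) = 0" for h
    unfolding left[of h m "(p,v)" "(p,w)", symmetric]
    by (rule sum_only(2)[symmetric, OF _ refl, of p])
       (auto simp: v vanish_pair intro!: sum.neutral)
  hence e: "x$p$h$1 * T (p,m,1) (p,v) (p,w) + x$p$h$2 * T (p,m,2) (p,v) (p,w) = 0" for h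
    by (simp add: sum_2)
  have "D2 x p p \<noteq> 0" using xX by (simp add: X_circ_def)
  moreover have "D2 x p p * T (p,m,1) (p,v) (p,w) = 0" "D2 x p p * T (p,m,2) (p,v) (p,w) = 0"
    unfolding D2_def using e[of 1] e[of 2] by algebra+
  ultimately show ?thesis using exhaust_2[of j] by auto
qed

lemma vanish: "T a b c = 0"
proof -
  obtain p i j q k l r m n where [simp]: "a = (p,i,j)" "b = (q,k,l)" "c = (r,m,n)"
    by (metis surj_pair)
  consider "p = q" "q = r" | "p = q" "q \<noteq> r" | "p = r" "q \<noteq> r" | "q = r" "p \<noteq> q" | "p \<noteq> q" "q \<noteq> r" "r \<noteq> p"
    by blast
  thus ?thesis
  proof cases
    case 2
    have "T a b c = T c a b" using sym12 sym23 by metis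
    thus ?thesis using 2 by (simp add: vanish_pair)
  next
    case 3
    have "T a b c = T b a c" by (rule sym12)
    thus ?thesis using 3 by (simp add: vanish_pair)
  qed (simp_all add: vanish_single vanish_pair vanish_distinct)
qed

end

section \<open>The system in the coordinates of the matrix entries\<close>

definition flat :: "pt \<Rightarrow> complex ^ idx" where
  "flat z = (\<chi> m. case m of (p, j, k) \<Rightarrow> z $ p $ j $ k)"

definition unflat :: "complex ^ idx \<Rightarrow> pt" where
  "unflat y = (\<chi> p j k. y $ (p, j, k))"

lemma flat_unflat [simp]: "flat (unflat y) = y" "unflat (flat z) = z"
  by (auto simp: flat_def unflat_def vec_eq_iff)

lemma flat_nth [simp]: "flat z $ (p, j, k) = z $ p $ j $ k"
  and unflat_nth [simp]: "unflat y $ p $ j $ k = y $ (p, j, k)"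
  by (simp_all add: flat_def unflat_def)

lemma continuous_on_flat: "continuous_on S flat"
proof -
  have "continuous_on S (\<lambda>z. \<chi> m. z $ fst m $ fst (snd m) $ snd (snd m))" by (intro continuous_intros)
  thus ?thesis unfolding flat_def split_beta .
qed

lemma continuous_on_unflat: "continuous_on S unflat"
  unfolding unflat_def by (intro continuous_intros)

lemma shift_unflat: "shift p j k (unflat y) t = unflat (y + t *s axis (p, j, k) 1)"
  by (auto simp: shift_def vec_eq_iff axis_def)

lemma pd_unflat: "pd p j k u (unflat y) = cpd (p, j, k) (\<lambda>y. u (unflat y)) y"
  by (simp add: pd_def cpd_def shift_unflat)

lemma partially_differentiable_unflat:
  "partially_differentiable p j k u (unflat y) \<longleftrightarrow>
     (\<lambda>t. u (unflat (y + t *s axis (p, j, k) 1))) field_differentiable (at 0)"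
  by (simp add: partially_differentiable_def shift_unflat)

text \<open>The last entry is the sum of the four homogeneity equations of degree -1/2. It is listed
  separately to provide the Euler equation in all variables, of degree -2, that
  \<open>system_extension\<close> asks for.\<close>

definition first_order :: "idx eq1 set" where
  "first_order =
     range (\<lambda>p. ({p} \<times> UNIV \<times> UNIV, id, - 1 / 2)) \<union>
     range (\<lambda>(l, m). (UNIV \<times> {l} \<times> UNIV, \<lambda>(p, _, j). (p, m, j), - (if l = m then 1 else 0))) \<union>
     range (\<lambda>(l, m). (UNIV \<times> UNIV \<times> {l}, \<lambda>(p, j, _). (p, j, m), - (if l = m then 1 else 0))) \<union>
     {(UNIV, id, - 2)}"

definition second_order :: "idx eq2 set" where
  "second_order =
     {(((q, i, j), (p, k, l)), ((q, k, l), (p, i, j))) | p q i j k l. True} \<union>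
     {(((q, 1, 1), (p, 2, 2)), ((q, 2, 1), (p, 1, 2))) | p q. True}"

lemma sum_Times: "(\<Sum>n\<in>A \<times> B \<times> C. f n) = (\<Sum>p\<in>A. \<Sum>j\<in>B. \<Sum>k\<in>C. f (p, j, k))"
  by (simp add: sum.cartesian_product split_beta)

lemma ball_first_order:
  "(\<forall>(J, \<beta>, c)\<in>first_order. P J \<beta> c) \<longleftrightarrow> P UNIV id (- 2) \<and>
     (\<forall>p. P ({p} \<times> UNIV \<times> UNIV) id (- 1 / 2)) \<and>
     (\<forall>l m. P (UNIV \<times> {l} \<times> UNIV) (\<lambda>(p, _, j). (p, m, j)) (- (if l = m then 1 else 0))) \<and>
     (\<forall>l m. P (UNIV \<times> UNIV \<times> {l}) (\<lambda>(p, j, _). (p, j, m)) (- (if l = m then 1 else 0)))"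
  by (simp add: first_order_def ball_Un)

lemma ball_second_order:
  "(\<forall>((a, b), (c, d))\<in>second_order. P a b c d) \<longleftrightarrow>
     (\<forall>p q i j k l. P (q, i, j) (p, k, l) (q, k, l) (p, i, j)) \<and>
     (\<forall>p q. P (q, 1, 1) (p, 2, 2) (q, 2, 1) (p, 1, 2))"
  unfolding second_order_def by fastforce

lemma solution_on_flat:
  assumes "solution_on V u"
  shows "system_solution first_order second_order (unflat -` V) (\<lambda>y. u (unflat y))"
proof -
  have "continuous_on V u" and d: "\<And>z p j k. z \<in> V \<Longrightarrow> partially_differentiable p j k u z"
    and e: "\<And>z. z \<in> V \<Longrightarrow> E1 u z \<and> E2 u z"
    using assms by (auto simp: solution_on_def)
  have "continuous_on (unflat -` V) (\<lambda>y. u (unflat y))"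
    by (rule continuous_on_compose2[OF \<open>continuous_on V u\<close> continuous_on_unflat]) auto
  moreover have "(\<lambda>t. u (unflat (y + t *s axis i 1))) field_differentiable (at 0)"
    if "y \<in> unflat -` V" for y i
    using d[of "unflat y"] that unfolding partially_differentiable_unflat by (cases i) auto
  ultimately have s: "sep_hol (unflat -` V) (\<lambda>y. u (unflat y))" by (simp add: sep_hol_def)
  have "(\<forall>(J, \<beta>, c)\<in>first_order. (\<Sum>n\<in>J. y $ n * cpd (\<beta> n) (\<lambda>y. u (unflat y)) y) = c * u (unflat y)) \<and>
     (\<forall>((a, b), (c, d))\<in>second_order. cpd a (cpd b (\<lambda>y. u (unflat y))) y = cpd c (cpd d (\<lambda>y. u (unflat y))) y)"
    if y: "y \<in> unflat -` V" for y
  proof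
    have E: "E1 u (unflat y)" "E2 u (unflat y)" using e y by auto
    have c: "(\<Sum>j\<in>UNIV. \<Sum>k\<in>UNIV. y $ (p, j, k) * cpd (p, j, k) (\<lambda>y. u (unflat y)) y) = - (1/2) * u (unflat y)" for p
      using E(1) by (simp add: E1_def pd_unflat)
    have "(\<Sum>p\<in>UNIV. \<Sum>j\<in>UNIV. \<Sum>k\<in>UNIV. y $ (p, j, k) * cpd (p, j, k) (\<lambda>y. u (unflat y)) y) = - 2 * u (unflat y)"
      unfolding c by simp
    hence "(\<Sum>n\<in>UNIV. y $ n * cpd n (\<lambda>y. u (unflat y)) y) = - 2 * u (unflat y)"
      by (simp add: sum_Times flip: UNIV_Times_UNIV)
    thus "\<forall>(J, \<beta>, c)\<in>first_order. (\<Sum>n\<in>J. y $ n * cpd (\<beta> n) (\<lambda>y. u (unflat y)) y) = c * u (unflat y)"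
      unfolding ball_first_order sum_Times using c E(1) by (simp add: E1_def pd_unflat)
    show "\<forall>((a, b), (c, d))\<in>second_order. cpd a (cpd b (\<lambda>y. u (unflat y))) y = cpd c (cpd d (\<lambda>y. u (unflat y))) y"
      unfolding ball_second_order using E(2) by (simp add: E2_def pd_unflat)
  qed
  thus ?thesis using s by (simp add: system_solution_def)
qed

lemma symbol_vanish:
  assumes x: "x \<in> X_circ" and T: "jet_relations first_order second_order (flat x) (\<lambda>_. 0) T"
  shows "T = (\<lambda>_. 0)"
proof -
  note T' = T[unfolded jet_relations_def ball_first_order ball_second_order]
  note sym = T'[THEN conjunct1, rule_format]
    and E1 = T'[THEN conjunct2, THEN conjunct1, THEN conjunct2]
    and E2 = T'[THEN conjunct2, THEN conjunct2]
  have *: "(\<Sum>j\<in>UNIV. \<Sum>k\<in>UNIV. x$p$j$k * T ((p, j, k), v, w)) = 0"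
    "(\<Sum>p\<in>UNIV. \<Sum>j\<in>UNIV. x$p$l$j * T ((p, m, j), v, w)) = 0"
    "(\<Sum>p\<in>UNIV. \<Sum>j\<in>UNIV. x$p$j$l * T ((p, j, m), v, w)) = 0" for v w p l m
    using E1[THEN conjunct1, THEN spec[of _ p], THEN spec[of _ v], THEN spec[of _ w]]
      E1[THEN conjunct2, THEN conjunct1,
        THEN spec[of _ l], THEN spec[of _ m], THEN spec[of _ v], THEN spec[of _ w]]
      E1[THEN conjunct2, THEN conjunct2,
        THEN spec[of _ l], THEN spec[of _ m], THEN spec[of _ v], THEN spec[of _ w]]
    unfolding sum_Times by simp_all
  interpret symbol_kernel x "\<lambda>a b c. T (a, b, c)"
    by unfold_locales (fact x sym[THEN conjunct1] sym[THEN conjunct2] * E2[THEN conjunct1, rule_format]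
        E2[THEN conjunct2, rule_format])+
  show ?thesis using vanish by auto
qed

theorem theorem4:
  fixes x :: "complex ^ 2 ^ 2 ^ 4"
  assumes "x \<in> X_circ"
  shows "\<exists>B. open B \<and> x \<in> B \<and>
           (\<forall>V u. open V \<and> connected V \<and> V \<noteq> {} \<and> V \<subseteq> B \<and> solution_on V u \<longrightarrow>
              (\<exists>w. holomorphic_pt_on B w \<and> (\<forall>z\<in>V. w z = u z)))"
proof -
  obtain r where r: "0 < r" and ext: "\<And>V u. \<lbrakk>open V; connected V; V \<noteq> {}; V \<subseteq> ball (flat x) r;
        system_solution first_order second_order V u\<rbrakk>
      \<Longrightarrow> \<exists>w. sep_hol (ball (flat x) r) w \<and> (\<forall>z\<in>V. w z = u z)"
    by (rule system_extension[OF symbol_vanish[OF assms], where c = "-2"]) (auto simp: first_order_def)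
  define B where "B = flat -` ball (flat x) r"
  have "open B" unfolding B_def by (rule open_vimage[OF open_ball continuous_on_flat])
  moreover have "x \<in> B" using r by (simp add: B_def)
  moreover have "\<exists>w. holomorphic_pt_on B w \<and> (\<forall>z\<in>V. w z = u z)"
    if V: "open V" "connected V" "V \<noteq> {}" "V \<subseteq> B" and u: "solution_on V u" for V u
  proof -
    \<comment> \<open>As a preimage the set is seen to be open, as an image to be connected.\<close>
    have im: "unflat -` V = flat ` V" by (auto simp: image_iff) (metis flat_unflat(1))
    have "\<exists>w. sep_hol (ball (flat x) r) w \<and> (\<forall>z\<in>unflat -` V. w z = u (unflat z))"
    proof (rule ext)
      show "open (unflat -` V)" by (rule open_vimage[OF V(1) continuous_on_unflat])
      show "connected (unflat -` V)"
        unfolding im by (rule connected_continuous_image[OF continuous_on_flat V(2)])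
      show "unflat -` V \<noteq> {}" "unflat -` V \<subseteq> ball (flat x) r"
        unfolding im using V(3,4) by (auto simp: B_def)
      show "system_solution first_order second_order (unflat -` V) (\<lambda>z. u (unflat z))"
        by (rule solution_on_flat[OF u])
    qed
    then obtain w where w: "sep_hol (ball (flat x) r) w" "\<And>y. y \<in> unflat -` V \<Longrightarrow> w y = u (unflat y)"
      by blast
    have "holomorphic_pt_on B (\<lambda>z. w (flat z))"
      unfolding holomorphic_pt_on_def
    proof
      fix z assume "z \<in> B"
      hence z: "flat z \<in> ball (flat x) r" by (simp add: B_def)
      have "linear flat" by (rule linearI) (auto simp: flat_def vec_eq_iff)
      hence "(flat has_derivative flat) (at z)"
        by (intro bounded_linear.has_derivative[of flat "\<lambda>z. z" "\<lambda>z. z", simplified])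
           (auto simp: linear_conv_bounded_linear)
      from has_derivative_compose[OF this osgood[OF open_ball w(1) z]]
      have "((\<lambda>z. w (flat z)) has_derivative (\<lambda>h. \<Sum>i\<in>UNIV. cpd i w (flat z) * flat h $ i)) (at z)" .
      hence "((\<lambda>z. w (flat z)) has_derivative (\<lambda>h. \<Sum>p\<in>UNIV. \<Sum>j\<in>UNIV. \<Sum>k\<in>UNIV.
          (\<chi> p j k. cpd (p, j, k) w (flat z)) $ p $ j $ k * h $ p $ j $ k)) (at z)"
        by (simp add: sum_Times flip: UNIV_Times_UNIV)
      thus "\<exists>c :: pt. ((\<lambda>z. w (flat z)) has_derivative
          (\<lambda>h. \<Sum>p\<in>UNIV. \<Sum>j\<in>UNIV. \<Sum>k\<in>UNIV. c$p$j$k * h$p$j$k)) (at z)" by blast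
    qed
    moreover have "\<forall>z\<in>V. w (flat z) = u z" using w(2) by simp
    ultimately show ?thesis by blast
  qed
  ultimately show ?thesis by blast
qed

end
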